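(* For each $n\in\mathbb{N}\cup\{\infty\}$, the set $Y_3(n)$ is uncountable.
   Context: For an irrational $x$, $k(x)=\sup\{c>0 : |x-p/q|<\frac{1}{cq^2}$ has infinitely many rational solutions $p/q\}$. For $n\in\mathbb{N}\cup\{\infty\}$, $X_3(n)$ is the set of irrationals $x$ with $k(x)=3$ such that $|x-p/q|<\frac{1}{3q^2}$ has exactly $n$ rational solutions $p/q$ ($n=\infty$ meaning infinitely many). Let $\Sigma=(\mathbb{N}^* )^{\mathbb{Z}}$ with $\mathbb{N}^*=\{1,2,\dots\}$, and for $\underline{x}=(x_i)_{i\in\mathbb{Z}}\in\Sigma$ let $\lambda(\underline{x})=[x_0;x_1,x_2,\dots]+[0;x_{-1},x_{-2},\dots]$, let $\sigma$ be the shift $(\sigma\underline{x})_i=x_{i-1}$, and let $m(\underline{x})=\sup_{n\in\mathbb{Z}}\lambda(\sigma^n(\underline{x}))$ (Markov value). Let $\pi(\underline{x})=(x_i)_{i\ge 0}$. Then $Y_3(n)=\{x\in X_3(n): x=[0;x_0,x_1,x_2,\dots]$ where $(x_i)_{i\ge0}=\pi(\underline{x})$ for some $\underline{x}\in\Sigma$ with $m(\underline{x})=3\}$. *)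

theory Defs
  imports "HOL-Analysis.Analysis"
begin

text \<open>Solutions are counted as rational numbers. As \<^const>\<open>quotient_of\<close> yields the reduced
  fraction with positive denominator, and an unreduced fraction satisfying the inequality
  forces the reduced one to satisfy it, these are exactly the rationals that have some
  representation \<open>p/q\<close> satisfying the inequality (see \<open>approx_solutions_eq\<close>).\<close>

definition approx_solutions :: "real \<Rightarrow> real \<Rightarrow> rat set" where
  "approx_solutions c x =
     {r. \<exists>p q. quotient_of r = (p, q) \<and>
         \<bar>x - real_of_int p / real_of_int q\<bar> < 1 / (c * (real_of_int q)\<^sup>2)}"

text \<open>The supremum is taken in the extended reals, since it is infinite for
  irrationals that are not badly approximable.\<close>

definition lagrange_value :: "real \<Rightarrow> ereal" where
  "lagrange_value x = (SUP c\<in>{c. c > 0 \<and> infinite (approx_solutions c x)}. ereal c)"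

definition num_solutions3 :: "real \<Rightarrow> enat" where
  "num_solutions3 x =
     (if finite (approx_solutions 3 x) then enat (card (approx_solutions 3 x)) else \<infinity>)"

definition X3 :: "enat \<Rightarrow> real set" where
  "X3 n = {x. x \<notin> \<rat> \<and> lagrange_value x = 3 \<and> num_solutions3 x = n}"

text \<open>\<open>cf_convergent a n = [a 0; a 1, \<dots>, a n]\<close>, and \<open>cf a = [a 0; a 1, a 2, \<dots>]\<close> is the limit;
  it exists whenever \<open>a i \<ge> 1\<close> for all \<open>i \<ge> 1\<close>, which is the only situation
  in which it is used below.\<close>

primrec cf_convergent :: "(nat \<Rightarrow> nat) \<Rightarrow> nat \<Rightarrow> real" where
  "cf_convergent a 0 = real (a 0)"
| "cf_convergent a (Suc n) = real (a 0) + 1 / cf_convergent (\<lambda>i. a (Suc i)) n"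

definition cf :: "(nat \<Rightarrow> nat) \<Rightarrow> real" where
  "cf a = lim (cf_convergent a)"

definition cf0 :: "(nat \<Rightarrow> nat) \<Rightarrow> real"  \<comment> \<open>\<open>[0; a 0, a 1, \<dots>]\<close>\<close> where
  "cf0 a = cf (case_nat 0 a)"

definition Sigma_seqs :: "(int \<Rightarrow> nat) set" where
  "Sigma_seqs = {x. \<forall>i. x i \<ge> 1}"

definition lambda_val :: "(int \<Rightarrow> nat) \<Rightarrow> real" where
  "lambda_val x = cf (\<lambda>i. x (int i)) + cf0 (\<lambda>i. x (- 1 - int i))"

definition shift :: "(int \<Rightarrow> nat) \<Rightarrow> int \<Rightarrow> nat" where
  "shift x = (\<lambda>i. x (i - 1))"

definition shift_power :: "int \<Rightarrow> (int \<Rightarrow> nat) \<Rightarrow> int \<Rightarrow> nat" where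
  "shift_power n = (if n \<ge> 0 then shift ^^ nat n else inv shift ^^ nat (- n))"

definition markov_value :: "(int \<Rightarrow> nat) \<Rightarrow> ereal" where
  "markov_value x = (SUP n. ereal (lambda_val (shift_power n x)))"

definition proj_nonneg :: "(int \<Rightarrow> nat) \<Rightarrow> nat \<Rightarrow> nat" where
  "proj_nonneg x = (\<lambda>i. x (int i))"

definition Y3 :: "enat \<Rightarrow> real set" where
  "Y3 n = {x \<in> X3 n. \<exists>s \<in> Sigma_seqs. markov_value s = 3 \<and> x = cf0 (proj_nonneg s)}"

lemma inv_shift: "inv shift x = (\<lambda>i. x (i + 1))"
proof -
  have "inj shift"
  proof (rule injI, rule ext)
    fix x y :: "int \<Rightarrow> nat" and i assume "shift x = shift y"
    from fun_cong[OF this, of "i + 1"] show "x i = y i" by (simp add: shift_def)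
  qed
  moreover have "shift (\<lambda>i. x (i + 1)) = x" by (simp add: shift_def)
  ultimately show ?thesis by (metis inv_f_f)
qed

lemma shift_power_apply: "shift_power n x i = x (i - n)"
proof -
  have 1: "(shift ^^ k) x i = x (i - int k)" for k i
    by (induction k arbitrary: i) (auto simp: shift_def algebra_simps)
  have 2: "(inv shift ^^ k) x i = x (i + int k)" for k i
    by (induction k arbitrary: i) (auto simp: inv_shift algebra_simps)
  show ?thesis by (simp add: shift_power_def 1 2)
qed

lemma approx_solutions_eq:
  assumes "c > 0"
  shows "approx_solutions c x =
    {r. \<exists>p q. q > 0 \<and> r = of_int p / of_int q \<and>
        \<bar>x - real_of_int p / real_of_int q\<bar> < 1 / (c * (real_of_int q)\<^sup>2)}" (is "_ = ?R")
proof (intro equalityI subsetI)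
  fix r assume "r \<in> approx_solutions c x"
  then obtain p q where "quotient_of r = (p, q)"
    "\<bar>x - real_of_int p / real_of_int q\<bar> < 1 / (c * (real_of_int q)\<^sup>2)"
    by (auto simp: approx_solutions_def)
  then show "r \<in> ?R" using quotient_of_denom_pos quotient_of_div by blast
next
  fix r assume "r \<in> ?R"
  then obtain p q where pq: "q > 0" "r = of_int p / of_int q"
    "\<bar>x - real_of_int p / real_of_int q\<bar> < 1 / (c * (real_of_int q)\<^sup>2)" by auto
  obtain a b where ab: "quotient_of r = (a, b)" by force
  have b: "b > 0" and cop: "coprime a b" and rab: "r = of_int a / of_int b"
    using ab quotient_of_denom_pos quotient_of_coprime quotient_of_div by blast+
  have "rat_of_int (a * q) = rat_of_int (p * b)"
    using rab pq(1,2) b by (simp add: field_simps)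
  then have eq: "a * q = p * b" by (simp only: of_int_eq_iff)
  have "b dvd a * q" by (simp add: eq)
  then have "b dvd q" using cop by (simp add: coprime_commute coprime_dvd_mult_right_iff)
  then have "b \<le> q" using pq(1) by (simp add: zdvd_imp_le)
  have req: "real_of_int a / real_of_int b = real_of_int p / real_of_int q"
    using eq pq(1) b by (simp add: field_simps flip: of_int_mult)
  have "1 / (c * (real_of_int q)\<^sup>2) \<le> 1 / (c * (real_of_int b)\<^sup>2)"
    using b \<open>b \<le> q\<close> assms by (intro divide_left_mono mult_left_mono power_mono) auto
  then show "r \<in> approx_solutions c x"
    using pq(3) ab req by (auto simp: approx_solutions_def)
qed

end

theory Submission
  imports Defs
begin

text \<open>For an irrational slope \<open>\<theta>\<close> let \<open>u\<close> be the bi-infinite word \<open>u i = \<lfloor>(i + 1) \<theta>\<rfloor> - \<lfloor>i \<theta>\<rfloor>\<close>, and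
  substitute \<open>1 \<mapsto> 22\<close>, \<open>0 \<mapsto> 11\<close>. The identity \<open>[2; 2, y] + [0; 1, 1, y] = 3\<close> and the lexicographic
  monotonicity of continued fractions in the doubled letters turn the balance of \<open>u\<close> into the
  bound \<open>3\<close> for the Markov value, which is approached along long palindromic extensions of \<open>10\<close>.
  By Legendre's theorem, the solutions of \<open>|x - p/q| < 1/(3 q\<^sup>2)\<close> for the point read off from the
  letter at position \<open>h\<close> on correspond to the palindromically extended factors
  \<open>rev w 1 0 w\<close> that begin at position \<open>h\<close>.

  There is no such factor for \<open>h = 0\<close>; for \<open>h = 1\<close> there are infinitely many, one for each best
  approximation of \<open>0\<close> by multiples of \<open>\<theta>\<close> from above. Decreasing \<open>h\<close> by one raises the count by at
  most one, and by recurrence the counts are unbounded as \<open>h\<close> tends to minus infinity; so every count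
  occurs for every \<open>\<theta>\<close>. Finally \<open>\<theta>\<close> is the letter frequency, so it is determined by the point.\<close>

section \<open>Continued fractions\<close>

lemma cf_convergent_bounds:
  assumes "\<And>i. a i \<ge> 1"
  shows "real (a 0) \<le> cf_convergent a n" "cf_convergent a n \<le> real (a 0) + 1"
proof -
  have "real (a 0) \<le> cf_convergent a n \<and> cf_convergent a n \<le> real (a 0) + 1"
    using assms
  proof (induction n arbitrary: a)
    case (Suc n)
    have "real (a (Suc 0)) \<ge> 1" using Suc.prems[of "Suc 0"] by simp
    moreover have "real (a (Suc 0)) \<le> cf_convergent (\<lambda>i. a (Suc i)) n"
      using Suc.IH[of "\<lambda>i. a (Suc i)"] Suc.prems by blast
    ultimately show ?case by simp
  qed simp
  then show "real (a 0) \<le> cf_convergent a n" "cf_convergent a n \<le> real (a 0) + 1" by auto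
qed

text \<open>Two digits at a time the map contracts: the images of \<open>u\<close> and
  \<open>v\<close> under \<open>1 / (c + 1 / u)\<close> differ by \<open>u - v\<close> over
  \<open>(c * u + 1) * (c * v + 1)\<close>, and both factors are at least 2.\<close>

lemma cf_convergent_diff:
  assumes "\<And>i. a i \<ge> 1"
  shows "\<bar>cf_convergent a (2 * k + m) - cf_convergent a (2 * k + n)\<bar> \<le> (1/4) ^ k"
  using assms
proof (induction k arbitrary: a)
  case 0
  have "real (a 0) \<le> cf_convergent a i \<and> cf_convergent a i \<le> real (a 0) + 1" for i
    using cf_convergent_bounds[of a i] 0 by blast
  from this[of m] this[of n] show ?case by (simp add: abs_le_iff)
next
  case (Suc k)
  let ?b = "\<lambda>i. a (Suc (Suc i))"
  define u where "u = cf_convergent ?b (2 * k + m)"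
  define v where "v = cf_convergent ?b (2 * k + n)"
  define c where "c = real (a 1)"
  have c: "c \<ge> 1" using Suc.prems[of 1] by (simp add: c_def)
  have b: "real (a 2) \<ge> 1" using Suc.prems[of 2] by simp
  have "real (a 2) \<le> cf_convergent ?b i" for i
    using cf_convergent_bounds(1)[of ?b i] Suc.prems by (simp add: numeral_2_eq_2)
  then have uv: "u \<ge> 1" "v \<ge> 1" unfolding u_def v_def using b by (blast intro: order_trans)+
  have IH: "\<bar>u - v\<bar> \<le> (1/4) ^ k"
    using Suc.IH[of ?b] Suc.prems by (simp add: u_def v_def)
  have cu: "c * u \<ge> 1" and cv: "c * v \<ge> 1"
    using mult_mono[OF c uv(1)] mult_mono[OF c uv(2)] c by auto
  have pos: "(c * u + 1) * (c * v + 1) \<ge> 2 * 2"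
    using cu cv by (intro mult_mono) auto
  have "cf_convergent a (2 * Suc k + m) - cf_convergent a (2 * Suc k + n)
      = 1 / (c + 1 / u) - 1 / (c + 1 / v)"
    by (simp add: u_def v_def c_def)
  also have "\<dots> = u / (c * u + 1) - v / (c * v + 1)"
    using uv by (simp add: field_simps)
  also have "\<dots> = (u - v) / ((c * u + 1) * (c * v + 1))"
    using cu cv by (simp add: field_simps)
  finally have "\<bar>cf_convergent a (2 * Suc k + m) - cf_convergent a (2 * Suc k + n)\<bar>
      = \<bar>u - v\<bar> / ((c * u + 1) * (c * v + 1))"
    using cu cv by (simp add: abs_mult)
  also have "\<dots> \<le> \<bar>u - v\<bar> / (2 * 2)"
    using pos cu cv by (intro divide_left_mono mult_pos_pos) auto
  also have "\<dots> \<le> (1/4) ^ Suc k" using IH by simp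
  finally show ?case .
qed

lemma cf_convergent_LIMSEQ:
  assumes "\<And>i. a i \<ge> 1"
  shows "cf_convergent a \<longlonglongrightarrow> cf a"
proof -
  have "Cauchy (cf_convergent a)"
  proof (rule metric_CauchyI)
    fix e :: real assume "e > 0"
    then obtain k where k: "(1/4::real) ^ k < e"
      using real_arch_pow_inv[of e "1/4"] by auto
    show "\<exists>M. \<forall>m\<ge>M. \<forall>n\<ge>M. dist (cf_convergent a m) (cf_convergent a n) < e"
    proof (intro exI allI impI)
      fix m n :: nat assume "2 * k \<le> m" "2 * k \<le> n"
      then obtain m' n' where "m = 2 * k + m'" "n = 2 * k + n'" by (metis le_Suc_ex)
      then show "dist (cf_convergent a m) (cf_convergent a n) < e"
        using cf_convergent_diff[of a k m' n', OF assms] k by (simp add: dist_real_def)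
    qed
  qed
  then have "convergent (cf_convergent a)" by (rule Cauchy_convergent)
  then show ?thesis unfolding cf_def by (rule convergent_LIMSEQ_iff[THEN iffD1])
qed

lemma cf_ge:
  assumes "\<And>i. a i \<ge> 1"
  shows "cf a \<ge> real (a 0)"
proof (rule LIMSEQ_le_const[OF cf_convergent_LIMSEQ[OF assms]])
  show "\<exists>N. \<forall>n\<ge>N. real (a 0) \<le> cf_convergent a n"
    using cf_convergent_bounds(1)[of a] assms by blast
qed

text \<open>\<open>a 0\<close> is left free so that the rule also applies inside \<open>cf0\<close>,
  where the leading digit is 0.\<close>

lemma cf_rec:
  assumes "\<And>i. a (Suc i) \<ge> 1"
  shows "cf a = real (a 0) + 1 / cf (\<lambda>i. a (Suc i))"
proof -
  have "cf (\<lambda>i. a (Suc i)) \<ge> real (a (Suc 0))" using cf_ge[of "\<lambda>i. a (Suc i)"] assms by simp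
  then have "cf (\<lambda>i. a (Suc i)) \<noteq> 0" using assms[of 0] by auto
  then have "(\<lambda>n. real (a 0) + 1 / cf_convergent (\<lambda>i. a (Suc i)) n)
      \<longlonglongrightarrow> real (a 0) + 1 / cf (\<lambda>i. a (Suc i))"
    by (intro tendsto_intros cf_convergent_LIMSEQ assms)
  then have "cf_convergent a \<longlonglongrightarrow> real (a 0) + 1 / cf (\<lambda>i. a (Suc i))"
    by (subst filterlim_sequentially_Suc[symmetric]) simp
  then show ?thesis unfolding cf_def[of a] by (rule limI)
qed

lemma cf_gt:
  assumes "\<And>i. a i \<ge> 1"
  shows "cf a > real (a 0)" "cf a > 1"
proof -
  have "cf (\<lambda>i. a (Suc i)) \<ge> real (a (Suc 0))" by (rule cf_ge) (rule assms)
  moreover have "real (a (Suc 0)) \<ge> 1" using assms[of "Suc 0"] by simp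
  ultimately have "cf (\<lambda>i. a (Suc i)) > 0" by linarith
  then show "cf a > real (a 0)" using cf_rec[of a] assms by simp
  with assms[of 0] show "cf a > 1" by auto
qed

lemma cf0_eq:
  assumes "\<And>i. a i \<ge> 1"
  shows "cf0 a = 1 / cf a"
  using cf_rec[of "case_nat 0 a"] assms by (simp add: cf0_def)

section \<open>Convergents and Legendre's theorem\<close>

text \<open>The indices are shifted by one: \<open>cf_num a (Suc k) / cf_den a (Suc k)\<close> is the
  convergent \<open>[0; a 0, \<dots>, a (k - 1)]\<close>, and index \<open>0\<close> carries the conventional \<open>1 / 0\<close>.\<close>

fun cf_num :: "(nat \<Rightarrow> nat) \<Rightarrow> nat \<Rightarrow> int" where
  "cf_num a 0 = 1"
| "cf_num a (Suc 0) = 0"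
| "cf_num a (Suc (Suc k)) = int (a k) * cf_num a (Suc k) + cf_num a k"

fun cf_den :: "(nat \<Rightarrow> nat) \<Rightarrow> nat \<Rightarrow> int" where
  "cf_den a 0 = 0"
| "cf_den a (Suc 0) = 1"
| "cf_den a (Suc (Suc k)) = int (a k) * cf_den a (Suc k) + cf_den a k"

lemma cf_det: "cf_num a k * cf_den a (Suc k) - cf_num a (Suc k) * cf_den a k = (-1) ^ k"
proof (induction k)
  case (Suc k)
  have "cf_num a (Suc k) * cf_den a (Suc (Suc k)) - cf_num a (Suc (Suc k)) * cf_den a (Suc k)
      = - (cf_num a k * cf_den a (Suc k) - cf_num a (Suc k) * cf_den a k)"
    by (simp add: left_diff_distrib distrib_left distrib_right mult.commute mult.left_commute)
  then show ?case by (simp only: Suc) simp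
qed simp

section \<open>Complete quotients and the quality of convergents\<close>

locale pos_cf =
  fixes a :: "nat \<Rightarrow> nat"
  assumes pos: "a i \<ge> 1"
begin

abbreviation "P \<equiv> cf_num a"
abbreviation "Q \<equiv> cf_den a"

definition tail :: "nat \<Rightarrow> real" where "tail k = cf (\<lambda>i. a (k + i))"

text \<open>The finite reversed expansion \<open>[0; a (k - 1), ..., a 0]\<close>, by
  \<open>bwd_Suc\<close>; \<open>tail k + bwd k\<close> is the one-sided analogue of
  \<open>lambda_val\<close>.\<close>

definition bwd :: "nat \<Rightarrow> real" where "bwd k = real_of_int (Q k) / real_of_int (Q (Suc k))"

lemma tail_rec: "tail k = real (a k) + 1 / tail (Suc k)"
  using cf_rec[of "\<lambda>i. a (k + i)"] pos by (simp add: tail_def)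

lemma tail_gt1: "tail k > 1"
  using cf_gt(2)[of "\<lambda>i. a (k + i)"] pos by (simp add: tail_def)

lemma den_pos: "Q (Suc k) \<ge> 1 \<and> Q k \<ge> 0"
proof (induction k)
  case (Suc k)
  have "int (a k) * Q (Suc k) \<ge> 1 * 1" using pos[of k] Suc by (intro mult_mono) auto
  then show ?case using Suc by simp
qed simp

lemma den_le: "Q (Suc k) \<le> Q (Suc (Suc k))"
proof -
  have "int (a k) * Q (Suc k) \<ge> 1 * Q (Suc k)" using pos[of k] den_pos[of k] by (intro mult_right_mono) auto
  then show ?thesis unfolding cf_den.simps using den_pos[of k] by linarith
qed

lemma den_mono: "j \<le> k \<Longrightarrow> Q (Suc j) \<le> Q (Suc k)"
  using lift_Suc_mono_le[of "\<lambda>k. Q (Suc k)"] den_le by blast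

lemma den_ge: "Q (Suc k) \<ge> int k"
proof (induction k)
  case (Suc k)
  show ?case
  proof (cases k)
    case (Suc j)
    have "int (a k) * Q (Suc k) \<ge> 1 * Q (Suc k)"
      using pos[of k] den_pos[of k] by (intro mult_right_mono) auto
    moreover have "Q k \<ge> 1" using den_pos[of j] Suc by simp
    ultimately show ?thesis using Suc.IH by simp
  qed (use den_pos[of 1] in simp)
qed simp

lemma bwd_0 [simp]: "bwd 0 = 0"
  by (simp add: bwd_def)

lemma bwd_Suc: "bwd (Suc k) = 1 / (real (a k) + bwd k)"
  using den_pos[of k] den_pos[of "Suc k"] by (simp add: bwd_def field_simps)

lemma bwd_nonneg: "bwd k \<ge> 0"
  using den_pos[of k] by (simp add: bwd_def)

text \<open>The usual expression of the number through its complete quotient, cleared of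
  denominators.\<close>

lemma cf0_eq_tail:
  "cf0 a * (tail k * Q (Suc k) + Q k) = tail k * P (Suc k) + P k"
proof (induction k)
  case 0
  then show ?case using cf0_eq[of a] pos tail_gt1[of 0] by (simp add: tail_def)
next
  case (Suc k)
  have "tail (Suc k) * tail k = tail (Suc k) * a k + 1"
    using tail_rec[of k] tail_gt1[of "Suc k"] by (simp add: field_simps)
  then have "tail (Suc k) * x * a k + x = tail (Suc k) * tail k * x" for x
    by algebra
  note this[of "Q (Suc k)"] this[of "P (Suc k)"]
  then have "tail (Suc k) * Q (Suc (Suc k)) + Q (Suc k) = tail (Suc k) * (tail k * Q (Suc k) + Q k)"
    "tail (Suc k) * P (Suc (Suc k)) + P (Suc k) = tail (Suc k) * (tail k * P (Suc k) + P k)"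
    by (simp_all add: algebra_simps)
  then show ?case using Suc by (metis mult.left_commute)
qed

definition err :: "nat \<Rightarrow> real" where "err k = Q k * cf0 a - P k"

lemma err_Suc: "err (Suc k) = (-1) ^ k / (tail k * Q (Suc k) + Q k)"
proof -
  have p: "tail k * Q (Suc k) + Q k > 0"
    using tail_gt1[of k] den_pos[of k] by (intro add_pos_nonneg mult_pos_pos) auto
  have "err (Suc k) * (tail k * Q (Suc k) + Q k)
      = Q (Suc k) * (cf0 a * (tail k * Q (Suc k) + Q k)) - P (Suc k) * (tail k * Q (Suc k) + Q k)"
    by (simp add: err_def algebra_simps)
  also have "\<dots> = real_of_int (P k * Q (Suc k) - P (Suc k) * Q k)"
    by (subst cf0_eq_tail) (simp add: algebra_simps)
  also have "\<dots> = (-1) ^ k" by (simp only: cf_det) simp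
  finally show ?thesis using p by (simp add: field_simps)
qed

lemma abs_err_Suc: "\<bar>err (Suc k)\<bar> = 1 / (Q (Suc k) * (tail k + bwd k))"
proof -
  have "tail k * Q (Suc k) + Q k > 0"
    using tail_gt1[of k] den_pos[of k] by (intro add_pos_nonneg mult_pos_pos) auto
  moreover have "tail k * Q (Suc k) + Q k = Q (Suc k) * (tail k + bwd k)"
    using den_pos[of k] by (simp add: bwd_def field_simps)
  ultimately show ?thesis by (simp add: err_Suc del: abs_mult)
qed

text \<open>The error of a convergent is exactly
  \<open>1 / ((tail k + bwd k) * (Q (Suc k))\<^sup>2)\<close>.\<close>

lemma convergent_approx_iff:
  fixes c :: real
  assumes "c > 0"
  shows "\<bar>cf0 a - P (Suc k) / Q (Suc k)\<bar> < 1 / (c * (Q (Suc k))\<^sup>2) \<longleftrightarrow> c < tail k + bwd k"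
proof -
  have q: "real_of_int (Q (Suc k)) > 0" using den_pos[of k] by simp
  have t: "tail k + bwd k > 0" using tail_gt1[of k] bwd_nonneg[of k] by simp
  have "cf0 a - P (Suc k) / Q (Suc k) = err (Suc k) / Q (Suc k)"
    using q by (simp add: err_def field_simps)
  then have "\<bar>cf0 a - P (Suc k) / Q (Suc k)\<bar> = 1 / ((tail k + bwd k) * (Q (Suc k))\<^sup>2)"
    using q by (simp add: abs_err_Suc power2_eq_square)
  moreover have "1 / ((tail k + bwd k) * (Q (Suc k))\<^sup>2) < 1 / (c * (Q (Suc k))\<^sup>2)
      \<longleftrightarrow> c * (Q (Suc k))\<^sup>2 < (tail k + bwd k) * (Q (Suc k))\<^sup>2"
    using q t assms by (subst inverse_eq_divide[symmetric])+ (rule inverse_less_iff_less; simp)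
  ultimately show ?thesis using q by simp
qed

lemma err_neq_0: "err (Suc k) \<noteq> 0"
proof -
  have "tail k * Q (Suc k) + Q k > 0"
    using tail_gt1[of k] den_pos[of k] by (intro add_pos_nonneg mult_pos_pos) auto
  then show ?thesis by (simp add: err_Suc)
qed

lemma abs_err_less: "\<bar>err (Suc k)\<bar> < 1 / Q (Suc k)"
proof -
  have q: "real_of_int (Q (Suc k)) > 0" using den_pos[of k] by simp
  have t: "tail k + bwd k > 1" using tail_gt1[of k] bwd_nonneg[of k] by simp
  then show ?thesis using q by (simp add: abs_err_Suc frac_less2)
qed

text \<open>If the number were \<open>u / v\<close>, then \<open>v * err (Suc k)\<close> would be a
  nonzero integer of absolute value below \<open>v / Q (Suc k)\<close>, which is at most 1 for
  \<open>k = nat v\<close>.\<close>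

lemma cf0_irrational: "cf0 a \<notin> \<rat>"
proof
  assume "cf0 a \<in> \<rat>"
  then obtain u v :: int where v: "v > 0" and uv: "cf0 a = of_int u / of_int v"
    by (metis Rats_cases')
  define k where "k = nat v"
  have q: "real_of_int (Q (Suc k)) \<ge> v" using den_ge[of k] v by (simp add: k_def)
  have vv: "real_of_int v > 0" using v by simp
  have "of_int v * err (Suc k) = of_int (Q (Suc k) * u - v * P (Suc k))"
    using v by (simp add: err_def uv algebra_simps)
  then have *: "\<bar>of_int v * err (Suc k)\<bar> = of_int \<bar>Q (Suc k) * u - v * P (Suc k)\<bar>"
    by (simp only: of_int_abs)
  have "of_int v * err (Suc k) \<noteq> 0" using err_neq_0 v by simp
  then have "real_of_int \<bar>Q (Suc k) * u - v * P (Suc k)\<bar> > 0" using * by linarith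
  then have "\<bar>Q (Suc k) * u - v * P (Suc k)\<bar> \<ge> 1" by linarith
  then have "\<bar>of_int v * err (Suc k)\<bar> \<ge> 1" unfolding * by linarith
  moreover have "\<bar>of_int v * err (Suc k)\<bar> < v * (1 / Q (Suc k))"
    using mult_strict_left_mono[OF abs_err_less[of k] vv] vv by (simp add: abs_mult)
  moreover have "v * (1 / Q (Suc k)) \<le> 1" using q vv by simp
  ultimately show False by linarith
qed

text \<open>For \<open>b\<close> between two consecutive denominators, \<open>(u, b)\<close> is
  written in the basis of the two convergents. Either it is a multiple of the first, or its error is
  at least as large, and then \<open>u * Q (Suc k) - P (Suc k) * b\<close> is an integer of absolute
  value below 1.\<close>

lemma Legendre:
  assumes b: "b > 0" and ab: "\<bar>cf0 a - of_int u / of_int b\<bar> < 1 / (2 * (of_int b)\<^sup>2)"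
  shows "\<exists>k. u * Q (Suc k) = P (Suc k) * b"
proof -
  have "finite {k. Q (Suc k) \<le> b}"
  proof (rule finite_subset[of _ "{..nat b}"], rule subsetI)
    fix k assume "k \<in> {k. Q (Suc k) \<le> b}"
    then show "k \<in> {..nat b}" using den_ge[of k] by simp
  qed simp
  moreover have "0 \<in> {k. Q (Suc k) \<le> b}" using b by simp
  ultimately have "\<exists>k. Q (Suc k) \<le> b \<and> \<not> Q (Suc (Suc k)) \<le> b"
    by (metis (no_types, lifting) Max_in Max_ge empty_iff lessI linorder_not_less mem_Collect_eq)
  then obtain k where k: "Q (Suc k) \<le> b" "b < Q (Suc (Suc k))" by auto
  let ?e = "(-1::int) ^ Suc k"
  have det: "P (Suc k) * Q (Suc (Suc k)) - P (Suc (Suc k)) * Q (Suc k) = ?e"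
    by (rule cf_det)
  have ee: "?e * ?e = 1" by (simp flip: power_add power_mult_distrib)
  \<comment> \<open>Cramer's rule; the determinant \<open>?e\<close> is a unit, so the coordinates
    are integers.\<close>
  define r where "r = ?e * (u * Q (Suc (Suc k)) - b * P (Suc (Suc k)))"
  define s where "s = ?e * (b * P (Suc k) - u * Q (Suc k))"
  have "r * P (Suc k) + s * P (Suc (Suc k))
      = ?e * (u * (P (Suc k) * Q (Suc (Suc k)) - P (Suc (Suc k)) * Q (Suc k)))"
    by (simp only: r_def s_def) algebra
  then have u: "u = r * P (Suc k) + s * P (Suc (Suc k))"
    unfolding det using ee by (simp add: mult.left_commute)
  have "r * Q (Suc k) + s * Q (Suc (Suc k))
      = ?e * (b * (P (Suc k) * Q (Suc (Suc k)) - P (Suc (Suc k)) * Q (Suc k)))"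
    by (simp only: r_def s_def) algebra
  then have bq: "b = r * Q (Suc k) + s * Q (Suc (Suc k))"
    unfolding det using ee by (simp add: mult.left_commute)
  show ?thesis
  proof (cases "s = 0")
    case True
    then show ?thesis using u bq by (intro exI[of _ k]) (simp add: algebra_simps)
  next
    case False
    have q1: "Q (Suc k) \<ge> 1" using den_pos by blast
    have q2: "Q (Suc (Suc k)) \<ge> 1" using den_pos by blast
    \<comment> \<open>\<open>0 < b < Q (Suc (Suc k))\<close> rules out coordinates of equal sign; as
      consecutive errors also have opposite signs, the two terms of the error add up without
      cancellation.\<close>
    have rs: "(r > 0 \<and> s < 0) \<or> (r < 0 \<and> s > 0)"
    proof -
      have "\<not> (s > 0 \<and> r \<ge> 0)"
      proof
        assume "s > 0 \<and> r \<ge> 0"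
        then have "r * Q (Suc k) \<ge> 0" "s * Q (Suc (Suc k)) \<ge> 1 * Q (Suc (Suc k))"
          using q1 q2 by (auto intro!: mult_right_mono)
        then show False using bq k by simp
      qed
      moreover have "\<not> (s < 0 \<and> r \<le> 0)"
      proof
        assume "s < 0 \<and> r \<le> 0"
        then have "r * Q (Suc k) \<le> 0" "s * Q (Suc (Suc k)) \<le> 0"
          using q1 q2 by (auto intro!: mult_nonpos_nonneg)
        then show False using bq b by simp
      qed
      ultimately show ?thesis using False by linarith
    qed
    have t: "tail k * Q (Suc k) + Q k > 0" for k
      using tail_gt1[of k] den_pos[of k] by (intro add_pos_nonneg mult_pos_pos) auto
    have opp: "err (Suc k) * err (Suc (Suc k)) < 0"
    proof -
      have "err (Suc k) * err (Suc (Suc k)) = - (((-1) ^ k * (-1) ^ k)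
          / ((tail k * Q (Suc k) + Q k) * (tail (Suc k) * Q (Suc (Suc k)) + Q (Suc k))))"
        by (simp add: err_Suc)
      moreover have "(-1::real) ^ k * (-1) ^ k = 1" by (simp flip: power_mult_distrib)
      ultimately show ?thesis using t[of k] t[of "Suc k"] by (simp del: cf_den.simps)
    qed
    have "of_int b * cf0 a - of_int u = r * err (Suc k) + s * err (Suc (Suc k))"
      unfolding err_def by (subst u, subst bq) (simp add: algebra_simps del: cf_den.simps cf_num.simps)
    moreover have "\<bar>r * err (Suc k) + s * err (Suc (Suc k))\<bar> \<ge> \<bar>r * err (Suc k)\<bar>"
    proof -
      have "(r * err (Suc k)) * (s * err (Suc (Suc k))) \<ge> 0"
      proof -
        have "real_of_int r * real_of_int s < 0"
          using rs by (auto simp: mult_less_0_iff)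
        then have "(real_of_int r * real_of_int s) * (err (Suc k) * err (Suc (Suc k))) > 0"
          using opp by (rule mult_neg_neg)
        then show ?thesis by (simp add: mult_ac)
      qed
      then show ?thesis by (auto simp: zero_le_mult_iff)
    qed
    moreover have "\<bar>r * err (Suc k)\<bar> \<ge> 1 * \<bar>err (Suc k)\<bar>"
      unfolding abs_mult using rs by (intro mult_right_mono) auto
    ultimately have e1: "\<bar>err (Suc k)\<bar> \<le> \<bar>of_int b * cf0 a - of_int u\<bar>" by simp
    have bpos: "real_of_int b > 0" using b by simp
    have "\<bar>of_int b * cf0 a - of_int u\<bar> = of_int b * \<bar>cf0 a - of_int u / of_int b\<bar>"
    proof -
      have "of_int b * cf0 a - of_int u = of_int b * (cf0 a - of_int u / of_int b)"
        using bpos by (simp add: field_simps)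
      then show ?thesis using bpos by (simp add: abs_mult)
    qed
    also have "\<dots> < of_int b * (1 / (2 * (of_int b)\<^sup>2))"
      using ab bpos by (intro mult_strict_left_mono)
    also have "\<dots> = 1 / (2 * of_int b)" using bpos by (simp add: power2_eq_square)
    finally have e2: "\<bar>of_int b * cf0 a - of_int u\<bar> < 1 / (2 * of_int b)" .
    have "real_of_int (u * Q (Suc k) - P (Suc k) * b)
        = of_int b * err (Suc k) - Q (Suc k) * (of_int b * cf0 a - of_int u)"
      by (simp add: err_def algebra_simps)
    then have "\<bar>real_of_int (u * Q (Suc k) - P (Suc k) * b)\<bar>
        \<le> of_int b * \<bar>err (Suc k)\<bar> + Q (Suc k) * \<bar>of_int b * cf0 a - of_int u\<bar>"
      using abs_triangle_ineq4[of "of_int b * err (Suc k)" "Q (Suc k) * (of_int b * cf0 a - of_int u)"]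
        bpos q1 by (simp add: abs_mult)
    also have "\<dots> < of_int b * (1 / (2 * of_int b)) + of_int b * (1 / (2 * of_int b))"
    proof (rule add_less_le_mono)
      show "of_int b * \<bar>err (Suc k)\<bar> < of_int b * (1 / (2 * real_of_int b))"
        using e1 e2 bpos by (intro mult_strict_left_mono) auto
      show "Q (Suc k) * \<bar>of_int b * cf0 a - of_int u\<bar> \<le> of_int b * (1 / (2 * real_of_int b))"
        using e2 bpos k q1 by (intro mult_mono) auto
    qed
    also have "\<dots> = 1" using bpos by simp
    finally have "real_of_int \<bar>u * Q (Suc k) - P (Suc k) * b\<bar> < 1" by simp
    then have "u * Q (Suc k) = P (Suc k) * b" by linarith
    then show ?thesis by blast
  qed
qed

definition conv :: "nat \<Rightarrow> rat" where "conv k = of_int (P (Suc k)) / of_int (Q (Suc k))"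

lemma quotient_of_conv: "quotient_of (conv k) = (P (Suc k), Q (Suc k))"
proof -
  have "coprime (P (Suc k)) (Q (Suc k))"
  proof (rule coprimeI)
    fix d assume "d dvd P (Suc k)" "d dvd Q (Suc k)"
    then have "d dvd P k * Q (Suc k) - P (Suc k) * Q k" by simp
    then show "is_unit d" unfolding cf_det by (rule dvd_trans) (simp add: is_unit_power_iff)
  qed
  then show ?thesis
    using den_pos[of k] by (simp add: conv_def Fract_of_int_quotient[symmetric] quotient_of_Fract normalize_stable)
qed

text \<open>Denominators can coincide only when the earlier one is \<open>Q 1\<close>; its numerator
  is 0, while all later numerators are positive.\<close>

lemma inj_conv: "inj conv"
proof (rule injI)
  fix j k assume *: "conv j = conv k"
  then have PQ: "P (Suc j) = P (Suc k)" "Q (Suc j) = Q (Suc k)"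
    using quotient_of_conv by (metis prod.inject)+
  show "j = k"
  proof (rule ccontr)
    assume "j \<noteq> k"
    have aux: False if "i < l" "P (Suc i) = P (Suc l)" "Q (Suc i) = Q (Suc l)" for i l
    proof -
      have "Q (Suc (Suc i)) \<le> Q (Suc l)" using den_mono[of "Suc i" l] that by simp
      then have eq: "Q (Suc (Suc i)) = Q (Suc i)" using den_le[of i] that by simp
      have "int (a i) * Q (Suc i) \<ge> 1 * Q (Suc i)"
        using pos[of i] den_pos[of i] by (intro mult_right_mono) auto
      then have "Q i = 0" using eq den_pos[of i] unfolding cf_den.simps by linarith
      then have i: "i = 0" using den_pos[of "i - 1"] by (cases i) auto
      have "P (Suc l) = 0" using that i by simp
      have "l \<ge> 1" using that by simp
      have "P (Suc (Suc m)) > 0 \<and> P (Suc m) \<ge> 0" for m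
      proof (induction m)
        case (Suc m)
        have "int (a (Suc m)) * P (Suc (Suc m)) > 0"
          using pos[of "Suc m"] Suc by (intro mult_pos_pos) auto
        then show ?case using Suc unfolding cf_num.simps(3)[of a "Suc m"] by linarith
      qed simp
      from this[of "l - 1"] show False using \<open>P (Suc l) = 0\<close> \<open>l \<ge> 1\<close> by simp
    qed
    show False using aux[of j k] aux[of k j] PQ \<open>j \<noteq> k\<close> by (metis linorder_neqE_nat)
  qed
qed

lemma conv_in_approx_solutions:
  assumes "c > 0"
  shows "conv k \<in> approx_solutions c (cf0 a) \<longleftrightarrow> c < tail k + bwd k"
  using convergent_approx_iff[OF assms, of k] by (simp add: approx_solutions_def quotient_of_conv)

lemma approx_solutions_conv:
  assumes "c \<ge> 2"
  shows "approx_solutions c (cf0 a) = conv ` {k. c < tail k + bwd k}"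
proof -
  have "r \<in> range conv" if r: "r \<in> approx_solutions c (cf0 a)" for r
  proof -
    obtain u b where ub: "quotient_of r = (u, b)"
      "\<bar>cf0 a - of_int u / of_int b\<bar> < 1 / (c * (real_of_int b)\<^sup>2)"
      using r by (auto simp: approx_solutions_def)
    have b: "b > 0" using ub quotient_of_denom_pos by blast
    have "1 / (c * (real_of_int b)\<^sup>2) \<le> 1 / (2 * (real_of_int b)\<^sup>2)"
      using b assms by (intro divide_left_mono mult_right_mono) auto
    then obtain k where "u * Q (Suc k) = P (Suc k) * b"
      using Legendre[OF b, of u] ub by auto
    then have "rat_of_int u * rat_of_int (Q (Suc k)) = rat_of_int (P (Suc k)) * rat_of_int b"
      by (simp flip: of_int_mult)
    then have "rat_of_int u / of_int b = conv k"
      using b den_pos[of k] by (simp add: conv_def field_simps)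
    then show ?thesis using ub quotient_of_div by auto
  qed
  then show ?thesis using conv_in_approx_solutions[of c] assms by auto
qed

end

section \<open>Continued fractions with doubled digits\<close>

text \<open>The value \<open>[0; c, c + w]\<close>: the effect of putting the doubled digit
  \<open>c, c\<close> in front of a remainder \<open>w\<close>.\<close>

definition digit_step :: "nat \<Rightarrow> real \<Rightarrow> real" where
  "digit_step c w = 1 / (real c + 1 / (real c + w))"

definition dbl :: "(nat \<Rightarrow> nat) \<Rightarrow> nat \<Rightarrow> nat" where
  "dbl S k = S (k div 2)"

definition dval :: "(nat \<Rightarrow> nat) \<Rightarrow> real" where
  "dval S = cf0 (dbl S)"

definition digits12 :: "(nat \<Rightarrow> nat) \<Rightarrow> bool" where
  "digits12 S \<longleftrightarrow> (\<forall>i. S i \<in> {1, 2})"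

lemma digits12_shift: "digits12 S \<Longrightarrow> digits12 (\<lambda>i. S (i + n))"
  by (simp add: digits12_def)

lemma digits12_Suc: "digits12 S \<Longrightarrow> digits12 (\<lambda>i. S (Suc i))"
  by (simp add: digits12_def)

lemma digits12_cases: "digits12 S \<Longrightarrow> S i = 1 \<or> S i = 2"
  by (auto simp: digits12_def)

lemma digits12_dbl_ge1: "digits12 S \<Longrightarrow> dbl S i \<ge> 1"
  using digits12_cases[of S "i div 2"] by (auto simp: dbl_def)

lemma cf_dbl:
  assumes "digits12 S"
  shows "cf (dbl S) = real (S 0) + 1 / (real (S 0) + dval (\<lambda>i. S (Suc i)))"
proof -
  have g: "dbl S i \<ge> 1" "dbl (\<lambda>i. S (Suc i)) i \<ge> 1" for i
    using digits12_dbl_ge1 digits12_Suc assms by blast+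
  have "cf (dbl S) = real (dbl S 0) + 1 / cf (\<lambda>i. dbl S (Suc i))"
    by (intro cf_rec g)
  also have "cf (\<lambda>i. dbl S (Suc i)) = real (dbl S 1) + 1 / cf (\<lambda>i. dbl S (Suc (Suc i)))"
    using cf_rec[of "\<lambda>i. dbl S (Suc i)"] g by simp
  also have "(\<lambda>i. dbl S (Suc (Suc i))) = dbl (\<lambda>i. S (Suc i))" by (rule ext) (simp add: dbl_def)
  also have "1 / cf (dbl (\<lambda>i. S (Suc i))) = dval (\<lambda>i. S (Suc i))"
    unfolding dval_def using g by (simp add: cf0_eq)
  finally have "cf (dbl S) = real (dbl S 0) + 1 / (real (dbl S 1) + dval (\<lambda>i. S (Suc i)))" .
  moreover have "dbl S 0 = S 0" "dbl S 1 = S 0" by (simp_all add: dbl_def)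
  ultimately show ?thesis by simp
qed

lemma dval_eq: "digits12 S \<Longrightarrow> dval S = 1 / cf (dbl S)"
  unfolding dval_def by (intro cf0_eq digits12_dbl_ge1)

lemma dval_rec:
  assumes "digits12 S"
  shows "dval S = digit_step (S 0) (dval (\<lambda>i. S (Suc i)))"
  using cf_dbl[OF assms] dval_eq[OF assms] by (simp add: digit_step_def)

lemma dval_bounds:
  assumes "digits12 S"
  shows "0 < dval S" "dval S < 1"
  using cf_gt(2)[of "dbl S"] digits12_dbl_ge1[OF assms] by (simp_all add: dval_eq[OF assms])

lemma cf_single_dbl:
  assumes "c \<ge> 1" "digits12 S"
  shows "cf (case_nat c (dbl S)) = real c + dval S"
  using cf_rec[of "case_nat c (dbl S)"] digits12_dbl_ge1[OF assms(2)] dval_eq[OF assms(2)] by simp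

text \<open>With \<open>w = [0; y]\<close> this is the identity
  \<open>[2; 2, y] + [0; 1, 1, y] = 3\<close>, since \<open>[2; 2, y]\<close> is
  \<open>2 + 1 / (2 + w)\<close>.\<close>

lemma digit_step_1: "w \<ge> 0 \<Longrightarrow> digit_step 1 w = 1 - 1 / (2 + w)"
  by (simp add: digit_step_def field_simps)

text \<open>The threshold 1/2 separates first letter 1 from first letter 2, whatever
  follows.\<close>

lemma digit_step_1_ge: "w \<ge> 0 \<Longrightarrow> digit_step 1 w \<ge> 1 / 2"
  by (simp add: digit_step_def field_simps)

lemma digit_step_2_less: "w \<ge> 0 \<Longrightarrow> digit_step 2 w < 1 / 2"
  by (simp add: digit_step_def field_simps)

lemma digit_step_le1: "w \<ge> 0 \<Longrightarrow> c \<ge> 1 \<Longrightarrow> digit_step c w \<le> 1"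
proof -
  assume "w \<ge> 0" "c \<ge> 1"
  then have "1 / (real c + w) \<ge> 0" "real c \<ge> 1" by auto
  then have "real c + 1 / (real c + w) \<ge> 1" by linarith
  then show ?thesis unfolding digit_step_def by simp
qed

lemma digit_step_nonneg: "w \<ge> 0 \<Longrightarrow> digit_step c w \<ge> 0"
  by (simp add: digit_step_def)

lemma digit_step_diff:
  assumes "c \<ge> 1" "v \<ge> 0" "w \<ge> 0"
  shows "digit_step c w - digit_step c v
    = (w - v) / ((real c * (real c + w) + 1) * (real c * (real c + v) + 1))"
proof -
  have c: "real c \<ge> 1" using assms by simp
  have *: "digit_step c u = (real c + u) / (real c * (real c + u) + 1)" if "u \<ge> 0" for u
    using c that by (simp add: digit_step_def field_simps)
  have "real c * (real c + w) + 1 > 0" "real c * (real c + v) + 1 > 0"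
    using assms by (auto intro!: add_nonneg_pos)
  moreover have "(real c + w) * (real c * (real c + v) + 1) - (real c + v) * (real c * (real c + w) + 1)
      = w - v" by (simp add: algebra_simps)
  ultimately show ?thesis
    using assms(2,3) by (simp add: * diff_frac_eq)
qed

lemma digit_step_less:
  assumes "c \<ge> 1" "0 \<le> v" "v < w"
  shows "digit_step c v < digit_step c w"
proof -
  have "(real c * (real c + w) + 1) * (real c * (real c + v) + 1) > 0"
    using assms by (auto intro!: mult_pos_pos add_nonneg_pos)
  then have "digit_step c w - digit_step c v > 0"
    using digit_step_diff[of c v w] assms by simp
  then show ?thesis by simp
qed

lemma digit_step_contract:
  assumes "c \<ge> 1" "v \<ge> 0" "w \<ge> 0"
  shows "\<bar>digit_step c w - digit_step c v\<bar> \<le> \<bar>w - v\<bar> / 4"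
proof -
  have *: "real c * (real c + u) + 1 \<ge> 2" if "u \<ge> 0" for u
  proof -
    have "real c * (real c + u) \<ge> 1 * 1" using assms(1) that by (intro mult_mono) auto
    then show ?thesis by simp
  qed
  have "(real c * (real c + w) + 1) * (real c * (real c + v) + 1) \<ge> 2 * 2"
    using *[OF assms(2)] *[OF assms(3)] by (intro mult_mono) auto
  then show ?thesis
    unfolding digit_step_diff[OF assms] abs_divide
    by (intro frac_le) auto
qed

section \<open>Prefixes followed by a remainder, and the lexicographic order\<close>

primrec steps :: "(nat \<Rightarrow> nat) \<Rightarrow> nat \<Rightarrow> real \<Rightarrow> real" where
  "steps S 0 w = w"
| "steps S (Suc n) w = digit_step (S 0) (steps (\<lambda>i. S (Suc i)) n w)"

lemma steps_nonneg: "w \<ge> 0 \<Longrightarrow> steps S n w \<ge> 0"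
  by (induction n arbitrary: S) (auto intro: digit_step_nonneg)

lemma steps_cong: "(\<And>i. i < n \<Longrightarrow> S i = R i) \<Longrightarrow> steps S n w = steps R n w"
proof (induction n arbitrary: S R)
  case (Suc n)
  have "steps (\<lambda>i. S (Suc i)) n w = steps (\<lambda>i. R (Suc i)) n w"
    by (rule Suc.IH) (use Suc.prems in simp)
  then show ?case using Suc.prems[of 0] by simp
qed simp

lemma steps_less:
  assumes "digits12 S" "0 \<le> v" "v < w"
  shows "steps S n v < steps S n w"
  using assms(1)
proof (induction n arbitrary: S)
  case (Suc n)
  have "S 0 \<ge> 1" using digits12_cases[OF Suc.prems, of 0] by auto
  then show ?case unfolding steps.simps
    using Suc.IH[OF digits12_Suc[OF Suc.prems]] steps_nonneg assms(2) by (intro digit_step_less)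
qed (use assms in auto)

lemma steps_diff:
  assumes "digits12 S" "0 \<le> v" "0 \<le> w"
  shows "\<bar>steps S n v - steps S n w\<bar> \<le> \<bar>v - w\<bar> / 4 ^ n"
  using assms(1)
proof (induction n arbitrary: S)
  case (Suc n)
  have "S 0 \<ge> 1" using digits12_cases[OF Suc.prems, of 0] by auto
  then have "\<bar>steps S (Suc n) v - steps S (Suc n) w\<bar>
      \<le> \<bar>steps (\<lambda>i. S (Suc i)) n v - steps (\<lambda>i. S (Suc i)) n w\<bar> / 4"
    unfolding steps.simps using assms by (intro digit_step_contract steps_nonneg)
  also have "\<dots> \<le> (\<bar>v - w\<bar> / 4 ^ n) / 4"
    using Suc.IH[OF digits12_Suc[OF Suc.prems]] by (intro divide_right_mono) auto
  finally show ?case by (simp add: field_simps)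
qed simp

lemma dval_steps: "digits12 S \<Longrightarrow> dval S = steps S n (dval (\<lambda>i. S (i + n)))"
proof (induction n arbitrary: S)
  case (Suc n)
  have "dval S = digit_step (S 0) (dval (\<lambda>i. S (Suc i)))" by (rule dval_rec[OF Suc.prems])
  also have "dval (\<lambda>i. S (Suc i)) = steps (\<lambda>i. S (Suc i)) n (dval (\<lambda>i. S (Suc (i + n))))"
    by (rule Suc.IH[OF digits12_Suc[OF Suc.prems]])
  finally show ?case by simp
qed simp

text \<open>The order is lexicographic with 2 below 1: the threshold 1/2 decides at the first
  difference, and each doubled letter before it acts as an increasing map, so signs do not alternate
  as they do for single digits. Arbitrary remainders allow finite words to be compared with infinite
  ones.\<close>

lemma steps_lex:
  assumes "digits12 S" "digits12 R" "\<And>i. i < n \<Longrightarrow> S i = R i" "S n = 2" "R n = 1" "0 \<le> v" "0 \<le> w"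
    "n < m" "n < k"
  shows "steps S m v < steps R k w"
  using assms(1-5,8,9)
proof (induction n arbitrary: S R m k)
  case 0
  obtain m' k' where "m = Suc m'" "k = Suc k'" using 0(6,7) by (metis less_imp_Suc_add)
  moreover have "S 0 = 2" "R 0 = 1" using 0 by auto
  ultimately have "steps S m v < 1 / 2" "steps R k w \<ge> 1 / 2"
    unfolding \<open>m = Suc m'\<close> \<open>k = Suc k'\<close> steps.simps
    using digit_step_2_less[OF steps_nonneg[OF assms(6)]] digit_step_1_ge[OF steps_nonneg[OF assms(7)]]
    by simp_all
  then show ?case by simp
next
  case (Suc n)
  obtain m' k' where mk: "m = Suc m'" "k = Suc k'" using Suc.prems by (metis less_imp_Suc_add)
  have "steps (\<lambda>i. S (Suc i)) m' v < steps (\<lambda>i. R (Suc i)) k' w"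
    using Suc.prems mk by (intro Suc.IH digits12_Suc) auto
  moreover have "S 0 = R 0" using Suc.prems(3)[of 0] by simp
  moreover have "S 0 \<ge> 1" using digits12_cases[OF Suc.prems(1), of 0] by auto
  ultimately show ?case
    using steps_nonneg[OF assms(6)] by (simp add: mk digit_step_less)
qed

lemma dval_lex:
  assumes "digits12 S" "digits12 R" "\<And>i. i < n \<Longrightarrow> S i = R i" "S n = 2" "R n = 1"
  shows "dval S < dval R"
proof -
  have "steps S (Suc n) (dval (\<lambda>i. S (i + Suc n))) < steps R (Suc n) (dval (\<lambda>i. R (i + Suc n)))"
    using assms(3-5) by (intro steps_lex assms(1,2) dval_bounds(1)[THEN less_imp_le] digits12_shift) auto
  then show ?thesis
    using dval_steps[OF assms(1), of "Suc n"] dval_steps[OF assms(2), of "Suc n"] by simp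
qed

lemma first_difference:
  fixes S R :: "nat \<Rightarrow> 'a"
  assumes "S \<noteq> R"
  obtains n where "\<And>i. i < n \<Longrightarrow> S i = R i" "S n \<noteq> R n"
proof -
  have "\<exists>n. S n \<noteq> R n" using assms by auto
  then obtain n where "S n \<noteq> R n" "\<forall>i<n. \<not> S i \<noteq> R i"
    using exists_least_iff[of "\<lambda>n. S n \<noteq> R n"] by blast
  then show ?thesis by (intro that[of n]) auto
qed

lemma dval_inj:
  assumes "digits12 S" "digits12 R" "dval S = dval R"
  shows "S = R"
proof (rule ccontr)
  assume "S \<noteq> R"
  from first_difference[OF this]
  obtain n where n: "\<And>i. i < n \<Longrightarrow> S i = R i" "S n \<noteq> R n" by metis
  consider "S n = 2" "R n = 1" | "S n = 1" "R n = 2"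
    using digits12_cases[OF assms(1), of n] digits12_cases[OF assms(2), of n] n(2) by linarith
  then show False
  proof cases
    case 1
    then show False using dval_lex[OF assms(1,2) n(1)] assms(3) by simp
  next
    case 2
    have "dval R < dval S" using 2 by (intro dval_lex[of R S n] assms n(1)[symmetric])
    then show False using assms(3) by simp
  qed
qed

lemma steps_add: "steps S (n + m) w = steps S n (steps (\<lambda>i. S (i + n)) m w)"
  by (induction n arbitrary: S) simp_all

lemma steps_le1:
  assumes "digits12 S" "0 \<le> w" "w \<le> 1"
  shows "steps S n w \<le> 1"
proof (cases n)
  case (Suc m)
  have "S 0 \<ge> 1" using digits12_cases[OF assms(1), of 0] by auto
  then show ?thesis using Suc steps_nonneg[OF assms(2)] by (simp add: digit_step_le1)
qed (use assms in simp)

lemma inverse_diff_le: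
  fixes u v :: real
  assumes "0 \<le> u" "0 \<le> v"
  shows "\<bar>1 / (2 + u) - 1 / (2 + v)\<bar> \<le> \<bar>u - v\<bar>"
proof -
  have "1 / (2 + u) - 1 / (2 + v) = (v - u) / ((2 + u) * (2 + v))"
    using assms by (simp add: diff_frac_eq)
  moreover have "(2 + u) * (2 + v) \<ge> 1 * 1" using assms by (intro mult_mono) auto
  ultimately show ?thesis
    by (simp add: abs_divide abs_minus_commute divide_le_eq mult_left_le mult_le_cancel_left1)
qed

section \<open>Words satisfying Markoff's condition\<close>

text \<open>Read outwards from a change of letter, the first mismatch between the two sides must
  show the letters swapped: \<open>z (i + 1)\<close> on the left and \<open>z i\<close> on the
  right.\<close>

locale markoff_word =
  fixes z :: "int \<Rightarrow> nat"
  assumes z12: "z i \<in> {1, 2}"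
    and markoff: "\<lbrakk>\<And>j. j < d \<Longrightarrow> z (i - 1 - int j) = z (i + 2 + int j); z i \<noteq> z (i + 1)\<rbrakk>
      \<Longrightarrow> \<not> (z (i - 1 - int d) = z i \<and> z (i + 2 + int d) = z (i + 1))"
begin

definition past :: "int \<Rightarrow> nat \<Rightarrow> nat" where "past i = (\<lambda>j. z (i - 1 - int j))"

definition future :: "int \<Rightarrow> nat \<Rightarrow> nat" where "future i = (\<lambda>j. z (i + int j))"

text \<open>A factor \<open>rev w 2 1 w\<close> with \<open>w\<close> of length \<open>d\<close>;
  \<open>past\<close> reads leftwards, so agreement with \<open>future\<close> is mirror
  symmetry.\<close>

definition pal :: "int \<Rightarrow> nat \<Rightarrow> bool" where
  "pal i d \<longleftrightarrow> z i = 2 \<and> z (i + 1) = 1 \<and> (\<forall>j<d. past i j = future (i + 2) j)"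

lemma z_cases: "z i = 1 \<or> z i = 2"
  using z12[of i] by auto

lemma digits12_past: "digits12 (past i)" and digits12_future: "digits12 (future i)"
  using z12 unfolding digits12_def past_def future_def by auto

lemmas dval_past = dval_bounds[OF digits12_past]
lemmas dval_future = dval_bounds[OF digits12_future]

lemma past_Suc: "(\<lambda>j. past i (Suc j)) = past (i - 1)" "past i 0 = z (i - 1)"
  by (auto simp: past_def algebra_simps)

lemma future_Suc: "(\<lambda>j. future i (Suc j)) = future (i + 1)" "future i 0 = z i"
  by (auto simp: future_def algebra_simps)

lemma dval_past_rec: "dval (past i) = digit_step (z (i - 1)) (dval (past (i - 1)))"
  using dval_rec[OF digits12_past[of i]] by (simp add: past_Suc)

lemma dval_future_rec: "dval (future i) = digit_step (z i) (dval (future (i + 1)))"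
  using dval_rec[OF digits12_future[of i]] by (simp add: future_Suc)

text \<open>The digit sequence doubles every letter of \<open>z\<close>; \<open>even_val i b\<close> and \<open>odd_val i b\<close> are the sums
  \<open>[s k; s (k + 1), \<dots>] + [0; s (k - 1), \<dots>]\<close> at \<open>k = 2 i\<close> and \<open>k = 2 i + 1\<close>, where \<open>b\<close> is the
  value of the digits before position \<open>2 i\<close>, infinitely or finitely many.\<close>

definition even_val :: "int \<Rightarrow> real \<Rightarrow> real" where
  "even_val i b = real (z i) + 1 / (real (z i) + dval (future (i + 1))) + b"

definition odd_val :: "int \<Rightarrow> real \<Rightarrow> real" where
  "odd_val i b = real (z i) + dval (future (i + 1)) + 1 / (real (z i) + b)"

text \<open>Crude digit bounds suffice away from 21: the three summands are at most 1, 1, 1 if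
  \<open>z i = 1\<close>, and 2, 1/2, 1/2 at 22.\<close>

lemma odd_val_le3:
  assumes "b \<ge> 0" "\<not> (z i = 2 \<and> z (i + 1) = 1)"
  shows "odd_val i b \<le> 3"
proof (cases "z i = 1")
  case True
  have "1 / (1 + b) \<le> 1" using assms by simp
  then show ?thesis using True dval_future(2)[of "i + 1"] by (simp add: odd_val_def)
next
  case False
  then have z: "z i = 2" "z (i + 1) = 2" using z_cases[of i] z_cases[of "i + 1"] assms by auto
  have "dval (future (i + 1)) < 1 / 2"
    using z digit_step_2_less[OF less_imp_le[OF dval_future(1)]] by (simp add: dval_future_rec[of "i + 1"])
  moreover have "1 / (2 + b) \<le> 1 / 2" using assms by (intro divide_left_mono) auto
  ultimately show ?thesis using z by (simp add: odd_val_def)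
qed

text \<open>By \<open>digit_step_1\<close>. At 21 the sign of the excess over 3 is thus decided by
  comparing the past \<open>b\<close> with the future beyond the pair.\<close>

lemma odd_val_eq:
  assumes "z i = 2" "z (i + 1) = 1"
  shows "odd_val i b = 3 + (1 / (2 + b) - 1 / (2 + dval (future (i + 2))))"
proof -
  have "i + 1 + 1 = i + 2" by simp
  then have "dval (future (i + 1)) = digit_step 1 (dval (future (i + 2)))"
    using dval_future_rec[of "i + 1"] assms by (simp only:)
  then show ?thesis
    using assms digit_step_1[OF less_imp_le[OF dval_future(1)], of "i + 2"] by (simp add: odd_val_def)
qed

lemma even_val_le3_first:
  assumes "b \<le> 1 / 2 \<or> z i = 1 \<and> b \<le> 1"
  shows "even_val i b \<le> 3"
proof -
  have "z i \<in> {1, 2}" by (rule z12)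
  moreover have "1 / (1 + dval (future (i + 1))) \<le> 1" "1 / (2 + dval (future (i + 1))) \<le> 1 / 2"
    using dval_future(1)[of "i + 1"] by (auto intro: divide_left_mono)
  ultimately show ?thesis using assms by (auto simp: even_val_def)
qed

text \<open>Here the critical pattern is 12, with \<open>digit_step_1\<close> applied to the past;
  the excess over 3 is \<open>1 / (2 + dval (future (i + 1))) - 1 / (2 + v)\<close>.\<close>

lemma even_val_le3:
  assumes "v \<ge> 0" "z (i - 1) = 1 \<Longrightarrow> z i = 2 \<Longrightarrow> v \<le> dval (future (i + 1))"
  shows "even_val i (digit_step (z (i - 1)) v) \<le> 3"
proof -
  consider "z (i - 1) = 2" | "z i = 1" | "z (i - 1) = 1" "z i = 2"
    using z_cases[of i] z_cases[of "i - 1"] by blast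
  then show ?thesis
  proof cases
    case 1
    then show ?thesis using digit_step_2_less[OF assms(1)] by (intro even_val_le3_first) auto
  next
    case 2
    have "z (i - 1) \<ge> 1" using z_cases[of "i - 1"] by auto
    then show ?thesis using 2 digit_step_le1[OF assms(1)] by (intro even_val_le3_first) auto
  next
    case 3
    have "1 / (2 + dval (future (i + 1))) \<le> 1 / (2 + v)"
      using assms 3 by (intro divide_left_mono) auto
    then show ?thesis using 3 digit_step_1[OF assms(1)] by (simp add: even_val_def)
  qed
qed

text \<open>Around 12 the first mismatch has 2 on the left and 1 on the right, and 2 is the smaller
  letter for \<open>dval\<close>; around 21 it is the other way round.\<close>

lemma dval_past_le_future:
  assumes "z i = 1" "z (i + 1) = 2"
  shows "dval (past i) \<le> dval (future (i + 2))"
proof (cases "past i = future (i + 2)")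
  case False
  from first_difference[OF this] obtain n
    where n: "\<And>j. j < n \<Longrightarrow> past i j = future (i + 2) j" "past i n \<noteq> future (i + 2) n" by metis
  have "\<not> (past i n = 1 \<and> future (i + 2) n = 2)"
    using markoff[of n i] n(1) assms by (simp add: past_def future_def)
  then have "past i n = 2" "future (i + 2) n = 1"
    using n(2) digits12_cases[OF digits12_past, of i n] digits12_cases[OF digits12_future, of "i + 2" n] by auto
  then show ?thesis using dval_lex[OF digits12_past digits12_future n(1), of n] by simp
qed simp

lemma dval_future_le_past:
  assumes "z i = 2" "z (i + 1) = 1"
  shows "dval (future (i + 2)) \<le> dval (past i)"
proof (cases "past i = future (i + 2)")
  case False
  from first_difference[OF this] obtain n
    where n: "\<And>j. j < n \<Longrightarrow> past i j = future (i + 2) j" "past i n \<noteq> future (i + 2) n" by metis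
  have "\<not> (past i n = 2 \<and> future (i + 2) n = 1)"
    using markoff[of n i] n(1) assms by (simp add: past_def future_def)
  then have "past i n = 1" "future (i + 2) n = 2"
    using n(2) digits12_cases[OF digits12_past, of i n] digits12_cases[OF digits12_future, of "i + 2" n] by auto
  then show ?thesis using dval_lex[OF digits12_future digits12_past n(1)[symmetric], of n] by simp
qed simp

lemma even_val_past_le3: "even_val i (dval (past i)) \<le> 3"
  unfolding dval_past_rec[of i] using dval_past_le_future[of "i - 1"]
  by (intro even_val_le3 less_imp_le[OF dval_past(1)]) (simp add: algebra_simps)

lemma odd_val_past_le3: "odd_val i (dval (past i)) \<le> 3"
proof (cases "z i = 2 \<and> z (i + 1) = 1")
  case True
  then have "1 / (2 + dval (past i)) \<le> 1 / (2 + dval (future (i + 2)))"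
    using dval_future_le_past[of i] dval_future(1)[of "i + 2"] by (intro divide_left_mono) auto
  then show ?thesis using True by (simp add: odd_val_eq)
qed (use odd_val_le3 dval_past(1)[of i] in auto)

section \<open>Finite pasts: which values exceed 3\<close>

definition fin_past :: "int \<Rightarrow> nat \<Rightarrow> real" where "fin_past i n = steps (past i) n 0"

lemma fin_past_nonneg: "fin_past i n \<ge> 0"
  by (simp add: fin_past_def steps_nonneg)

lemma fin_past_Suc: "fin_past i (Suc n) = digit_step (z (i - 1)) (fin_past (i - 1) n)"
  by (simp add: fin_past_def past_Suc)

text \<open>Truncation replaces the positive value of the remaining letters by 0, and
  \<open>steps\<close> is increasing. This deficit is the source of the solutions with constant
  3.\<close>

lemma fin_past_less_of_agree:
  assumes "\<And>j. j < n \<Longrightarrow> past i j = future k j"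
  shows "fin_past i n < dval (future k)"
proof -
  have "fin_past i n = steps (future k) n 0"
    unfolding fin_past_def using assms by (intro steps_cong)
  also have "\<dots> < steps (future k) n (dval (\<lambda>j. future k (j + n)))"
    by (intro steps_less digits12_future dval_bounds(1) digits12_shift) simp
  also have "\<dots> = dval (future k)" by (rule dval_steps[OF digits12_future, symmetric])
  finally show ?thesis .
qed

lemma fin_past_le_future:
  assumes "z i = 1" "z (i + 1) = 2"
  shows "fin_past i n \<le> dval (future (i + 2))"
proof (cases "\<forall>j<n. past i j = future (i + 2) j")
  case True
  then show ?thesis using fin_past_less_of_agree[of n i "i + 2"] by simp
next
  case False
  then obtain d where d: "d < n" "past i d \<noteq> future (i + 2) d"
    and agree: "\<And>j. j < d \<Longrightarrow> past i j = future (i + 2) j"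
    using exists_least_iff[of "\<lambda>j. j < n \<and> past i j \<noteq> future (i + 2) j"]
    by (metis order_less_trans)
  have "\<not> (past i d = 1 \<and> future (i + 2) d = 2)"
    using markoff[of d i] agree assms by (simp add: past_def future_def)
  then have "past i d = 2" "future (i + 2) d = 1"
    using d(2) digits12_cases[OF digits12_past, of i d] digits12_cases[OF digits12_future, of "i + 2" d] by auto
  then have "steps (past i) n 0 < steps (future (i + 2)) n (dval (\<lambda>j. future (i + 2) (j + n)))"
    using agree d(1) by (intro steps_lex[of _ _ d] digits12_past digits12_future
        less_imp_le[OF dval_bounds(1)] digits12_shift) auto
  then show ?thesis
    unfolding fin_past_def dval_steps[OF digits12_future[of "i + 2"], of n, symmetric] by simp
qed

text \<open>Without a mismatch, truncation makes the past smaller; at a first mismatch Markoff's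
  condition puts 1 on the left and 2 on the right, which makes the past larger.\<close>

lemma fin_past_less_future_iff:
  assumes "z i = 2" "z (i + 1) = 1"
  shows "fin_past i n < dval (future (i + 2)) \<longleftrightarrow> pal i n"
proof (cases "\<forall>j<n. past i j = future (i + 2) j")
  case True
  then show ?thesis using fin_past_less_of_agree[of n i "i + 2"] assms by (simp add: pal_def)
next
  case False
  then obtain d where d: "d < n" "past i d \<noteq> future (i + 2) d"
    and agree: "\<And>j. j < d \<Longrightarrow> past i j = future (i + 2) j"
    using exists_least_iff[of "\<lambda>j. j < n \<and> past i j \<noteq> future (i + 2) j"]
    by (metis order_less_trans)
  have "\<not> (past i d = 2 \<and> future (i + 2) d = 1)"
    using markoff[of d i] agree assms by (simp add: past_def future_def)
  then have "past i d = 1" "future (i + 2) d = 2"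
    using d(2) digits12_cases[OF digits12_past, of i d] digits12_cases[OF digits12_future, of "i + 2" d] by auto
  then have "steps (future (i + 2)) n (dval (\<lambda>j. future (i + 2) (j + n))) < steps (past i) n 0"
    using agree[symmetric] d(1) by (intro steps_lex[of _ _ d] digits12_past digits12_future
        less_imp_le[OF dval_bounds(1)] digits12_shift) auto
  then have "dval (future (i + 2)) < fin_past i n"
    unfolding fin_past_def dval_steps[OF digits12_future[of "i + 2"], of n, symmetric] by simp
  then show ?thesis using False by (auto simp: pal_def)
qed

lemma odd_val_fin_gt3_iff: "odd_val i (fin_past i n) > 3 \<longleftrightarrow> pal i n"
proof (cases "z i = 2 \<and> z (i + 1) = 1")
  case True
  have "odd_val i (fin_past i n) > 3 \<longleftrightarrow> 1 / (2 + dval (future (i + 2))) < 1 / (2 + fin_past i n)"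
    using True by (simp add: odd_val_eq)
  also have "\<dots> \<longleftrightarrow> fin_past i n < dval (future (i + 2))"
    using fin_past_nonneg[of i n] dval_future(1)[of "i + 2"] by (simp add: divide_less_eq field_simps)
  finally show ?thesis using fin_past_less_future_iff True by simp
next
  case False
  then show ?thesis using odd_val_le3[OF fin_past_nonneg, of i i n] by (auto simp: pal_def)
qed

lemma even_val_fin_le3: "even_val i (fin_past i n) \<le> 3"
proof (cases n)
  case 0
  then show ?thesis using even_val_le3_first[of 0 i] by (simp add: fin_past_def)
next
  case (Suc m)
  show ?thesis unfolding Suc fin_past_Suc
    using fin_past_le_future[of "i - 1" m]
    by (intro even_val_le3 fin_past_nonneg) (simp add: algebra_simps)
qed

text \<open>\<open>d\<close> common letters bring past and future within \<open>(1 / 4) ^ d\<close>.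
  The value \<open>v\<close> of what lies beyond them is free, so that infinite and truncated pasts
  are both covered.\<close>

lemma pal_odd_val_near3:
  assumes "pal i d" "0 \<le> v" "v \<le> 1" and b: "b = steps (past i) d v"
  shows "\<bar>odd_val i b - 3\<bar> \<le> (1 / 4) ^ d"
proof -
  define w where "w = dval (\<lambda>j. future (i + 2) (j + d))"
  have w: "0 < w" "w < 1" unfolding w_def
    by (intro dval_bounds digits12_shift digits12_future)+
  have "steps (past i) d v = steps (future (i + 2)) d v"
    using assms(1) by (intro steps_cong) (simp add: pal_def)
  moreover have "dval (future (i + 2)) = steps (future (i + 2)) d w"
    unfolding w_def by (rule dval_steps[OF digits12_future])
  ultimately have "\<bar>b - dval (future (i + 2))\<bar> \<le> \<bar>v - w\<bar> / 4 ^ d"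
    using steps_diff[OF digits12_future[of "i + 2"] assms(2) less_imp_le[OF w(1)], of d] b by simp
  also have "\<dots> \<le> 1 / 4 ^ d" using w assms(2,3) by (intro divide_right_mono) auto
  finally have "\<bar>b - dval (future (i + 2))\<bar> \<le> (1 / 4) ^ d" by (simp add: power_one_over)
  moreover have "b \<ge> 0" unfolding b by (rule steps_nonneg[OF assms(2)])
  ultimately show ?thesis
    using inverse_diff_le[of b "dval (future (i + 2))"] less_imp_le[OF dval_future(1)[of "i + 2"]]
      assms(1) by (simp add: odd_val_eq pal_def)
qed

section \<open>The bi-infinite digit sequence and its Markov value\<close>

definition digs :: "int \<Rightarrow> nat" where "digs k = z (k div 2)"

lemma digs_ge1: "digs k \<ge> 1"
  using z_cases[of "k div 2"] by (auto simp: digs_def)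

lemma digs_forward: "(\<lambda>j. digs (2 * i + int j)) = dbl (future i)"
  "(\<lambda>j. digs (2 * i + 1 + int j)) = case_nat (z i) (dbl (future (i + 1)))"
proof -
  have "(2 * i + int j) div 2 = i + int (j div 2)" for j i by linarith
  then show 1: "(\<lambda>j. digs (2 * i + int j)) = dbl (future i)" for i
    by (simp add: digs_def dbl_def future_def fun_eq_iff)
  show "(\<lambda>j. digs (2 * i + 1 + int j)) = case_nat (z i) (dbl (future (i + 1)))"
  proof
    fix j show "digs (2 * i + 1 + int j) = case_nat (z i) (dbl (future (i + 1))) j"
      using fun_cong[OF 1[of "i + 1"], of "j - 1"] by (cases j) (simp_all add: digs_def algebra_simps)
  qed
qed

lemma digs_backward: "(\<lambda>j. digs (2 * i - 1 - int j)) = dbl (past i)"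
  "(\<lambda>j. digs (2 * i - int j)) = case_nat (z i) (dbl (past i))"
proof -
  have "(2 * i - 1 - int j) div 2 = i - 1 - int (j div 2)" for j i by linarith
  then show 1: "(\<lambda>j. digs (2 * i - 1 - int j)) = dbl (past i)" for i
    by (simp add: digs_def dbl_def past_def fun_eq_iff)
  show "(\<lambda>j. digs (2 * i - int j)) = case_nat (z i) (dbl (past i))"
  proof
    fix j show "digs (2 * i - int j) = case_nat (z i) (dbl (past i)) j"
      using fun_cong[OF 1[of i], of "j - 1"] by (cases j) (simp_all add: digs_def algebra_simps)
  qed
qed

lemma z_ge1: "z i \<ge> 1"
  using z_cases[of i] by auto

text \<open>Positive exponents of \<open>shift_power\<close> move digits to the right, so the
  exponent \<open>- k\<close> brings digit \<open>k\<close> to the origin.\<close>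

lemma lambda_val_even: "lambda_val (shift_power (- (2 * i)) digs) = even_val i (dval (past i))"
proof -
  have "lambda_val (shift_power (- (2 * i)) digs) = cf (dbl (future i)) + cf0 (dbl (past i))"
    unfolding lambda_val_def shift_power_apply digs_forward(1)[symmetric] digs_backward(1)[symmetric]
    by (simp add: algebra_simps)
  also have "\<dots> = even_val i (dval (past i))"
    unfolding cf_dbl[OF digits12_future] future_Suc by (simp add: even_val_def dval_def)
  finally show ?thesis .
qed

lemma lambda_val_odd: "lambda_val (shift_power (- (2 * i + 1)) digs) = odd_val i (dval (past i))"
proof -
  have "lambda_val (shift_power (- (2 * i + 1)) digs)
      = cf (case_nat (z i) (dbl (future (i + 1)))) + cf0 (case_nat (z i) (dbl (past i)))"
    unfolding lambda_val_def shift_power_apply digs_forward(2)[symmetric] digs_backward(2)[symmetric]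
    by (simp add: algebra_simps)
  also have "cf0 (case_nat (z i) (dbl (past i))) = 1 / cf (case_nat (z i) (dbl (past i)))"
  proof (rule cf0_eq)
    show "case_nat (z i) (dbl (past i)) j \<ge> 1" for j
      using z_ge1 digits12_dbl_ge1[OF digits12_past] by (simp split: nat.split)
  qed
  also have "cf (case_nat (z i) (dbl (future (i + 1)))) + 1 / cf (case_nat (z i) (dbl (past i)))
      = odd_val i (dval (past i))"
    by (simp add: cf_single_dbl[OF z_ge1 digits12_past] cf_single_dbl[OF z_ge1 digits12_future] odd_val_def)
  finally show ?thesis .
qed

lemma lambda_val_le3: "lambda_val (shift_power n digs) \<le> 3"
proof (cases "even n")
  case True
  then obtain i where "n = - (2 * i)" by (metis dvd_def add.inverse_inverse mult_minus_right)
  then show ?thesis by (simp only: lambda_val_even even_val_past_le3)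
next
  case False
  then have "even (- n - 1)" by simp
  then obtain i where "- n - 1 = 2 * i" by (rule evenE)
  then have "n = - (2 * i + 1)" by simp
  then show ?thesis by (simp only: lambda_val_odd odd_val_past_le3)
qed

end

text \<open>Long palindromic factors bring the Markov value up to 3; their occurrence arbitrarily
  far to the right does the same for the Lagrange value.\<close>

locale recurrent_markoff_word = markoff_word +
  assumes recurrent: "\<exists>i\<ge>N. pal i d"
begin

lemma markov_value_eq3: "markov_value digs = 3"
proof (rule antisym)
  show "markov_value digs \<le> 3"
    unfolding markov_value_def by (rule SUP_least) (simp add: lambda_val_le3)
  show "3 \<le> markov_value digs"
  proof (rule dense_le)
    fix y :: ereal assume "y < 3"
    show "y \<le> markov_value digs"
    proof (cases y)
      case (real r)
      then have "3 - r > 0" using \<open>y < 3\<close> by simp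
      then obtain d where d: "(1 / 4) ^ d < 3 - r"
        using real_arch_pow_inv[of "3 - r" "1/4"] by auto
      obtain i where "pal i d" using recurrent[of 0] by blast
      moreover have "0 \<le> dval (\<lambda>j. past i (j + d))" "dval (\<lambda>j. past i (j + d)) \<le> 1"
        using dval_bounds[OF digits12_shift[OF digits12_past, of i d]] by simp_all
      moreover have "dval (past i) = steps (past i) d (dval (\<lambda>j. past i (j + d)))"
        by (rule dval_steps[OF digits12_past])
      ultimately have "\<bar>odd_val i (dval (past i)) - 3\<bar> \<le> (1 / 4) ^ d"
        by (rule pal_odd_val_near3)
      then have "r \<le> odd_val i (dval (past i))" using d by linarith
      then have "y \<le> ereal (lambda_val (shift_power (- (2 * i + 1)) digs))"
        unfolding lambda_val_odd real by simp
      also have "\<dots> \<le> markov_value digs" unfolding markov_value_def by (rule SUP_upper) simp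
      finally show ?thesis .
    qed (use \<open>y < 3\<close> in auto)
  qed
qed

section \<open>The point read off from position 0 and its approximations\<close>

abbreviation "pt \<equiv> cf0 (proj_nonneg digs)"

lemma proj_nonneg_digs: "proj_nonneg digs = dbl (future 0)"
  using digs_forward(1)[of 0] by (simp add: proj_nonneg_def)

sublocale cf: pos_cf "dbl (future 0)"
  by unfold_locales (rule digits12_dbl_ge1[OF digits12_future])

lemma tail_even: "cf.tail (2 * i) = cf (dbl (future (int i)))"
proof -
  have "dbl (future 0) (2 * i + j) = dbl (future (int i)) j" for j
    by (simp add: dbl_def future_def)
  then show ?thesis by (simp add: cf.tail_def)
qed

lemma tail_odd: "cf.tail (Suc (2 * i)) = real (z (int i)) + dval (future (int i + 1))"
proof -
  have "dbl (future 0) (Suc (2 * i) + j) = case_nat (z (int i)) (dbl (future (int i + 1))) j" for j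
    by (cases j) (simp_all add: dbl_def future_def algebra_simps)
  then have "cf.tail (Suc (2 * i)) = cf (case_nat (z (int i)) (dbl (future (int i + 1))))"
    by (simp add: cf.tail_def)
  then show ?thesis using cf_single_dbl[OF z_ge1 digits12_future] by simp
qed

lemma dbl_future_0: "dbl (future 0) (2 * i) = z (int i)" "dbl (future 0) (Suc (2 * i)) = z (int i)"
  by (simp_all add: dbl_def future_def)

text \<open>The expansion of \<open>pt\<close> starts at position 0, so exactly \<open>i\<close>
  letters precede position \<open>i\<close>; hence the truncation length equals the
  position.\<close>

lemma bwd_even: "cf.bwd (2 * i) = fin_past (int i) i"
proof (induction i)
  case 0
  then show ?case by (simp add: fin_past_def)
next
  case (Suc i)
  have "cf.bwd (2 * Suc i) = 1 / (real (z (int i)) + 1 / (real (z (int i)) + cf.bwd (2 * i)))"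
    using cf.bwd_Suc[of "2 * i"] cf.bwd_Suc[of "Suc (2 * i)"] by (simp add: dbl_future_0)
  also have "\<dots> = fin_past (int (Suc i)) (Suc i)"
    by (simp add: fin_past_Suc Suc digit_step_def)
  finally show ?case .
qed

lemma value_even: "cf.tail (2 * i) + cf.bwd (2 * i) = even_val (int i) (fin_past (int i) i)"
  unfolding tail_even bwd_even cf_dbl[OF digits12_future] future_Suc by (simp add: even_val_def)

lemma value_odd: "cf.tail (Suc (2 * i)) + cf.bwd (Suc (2 * i)) = odd_val (int i) (fin_past (int i) i)"
  unfolding tail_odd cf.bwd_Suc bwd_even dbl_future_0 by (simp add: odd_val_def)

lemma value_gt3:
  assumes "3 < cf.tail k + cf.bwd k"
  shows "\<exists>i. k = Suc (2 * i) \<and> pal (int i) i"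
proof (cases "even k")
  case True
  then obtain i where "k = 2 * i" by (rule evenE)
  then show ?thesis using assms even_val_fin_le3[of "int i" i] value_even[of i] by simp
next
  case False
  then obtain i where "k = 2 * i + 1" by (rule oddE)
  then have k: "k = Suc (2 * i)" by simp
  then have "pal (int i) i" using assms odd_val_fin_gt3_iff[of "int i" i] value_odd[of i] by simp
  with k show ?thesis by blast
qed

lemma value_gt3_set: "{k. 3 < cf.tail k + cf.bwd k} = (\<lambda>i. Suc (2 * i)) ` {i. pal (int i) i}"
proof (intro equalityI subsetI)
  fix k assume "k \<in> {k. 3 < cf.tail k + cf.bwd k}"
  then show "k \<in> (\<lambda>i. Suc (2 * i)) ` {i. pal (int i) i}" using value_gt3[of k] by blast
next
  fix k assume "k \<in> (\<lambda>i. Suc (2 * i)) ` {i. pal (int i) i}"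
  then show "k \<in> {k. 3 < cf.tail k + cf.bwd k}"
    using value_odd odd_val_fin_gt3_iff by auto
qed

text \<open>Solutions correspond to the palindromic factors that reach back exactly to position 0;
  injectivity of \<open>conv\<close> lets indices be counted in place of rationals.\<close>

lemma num_solutions3_eq:
  "num_solutions3 pt = (if finite {i. pal (int i) i} then enat (card {i. pal (int i) i}) else \<infinity>)"
proof -
  define f where "f = (\<lambda>i. cf.conv (Suc (2 * i)))"
  have inj: "inj_on f A" for A
    using cf.inj_conv unfolding f_def by (auto intro!: inj_onI dest: injD)
  have "approx_solutions 3 pt = f ` {i. pal (int i) i}"
    unfolding proj_nonneg_digs
    by (simp add: cf.approx_solutions_conv value_gt3_set image_image f_def)
  then show ?thesis
    unfolding num_solutions3_def by (simp add: finite_image_iff[OF inj] card_image[OF inj])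
qed

text \<open>A value above 3 at letter \<open>i\<close> requires \<open>i\<close> matched letters on
  each side and so exceeds 3 by at most \<open>(1 / 4) ^ i\<close>.\<close>

lemma finite_value_gt:
  assumes "c > 3"
  shows "finite {k. c < cf.tail k + cf.bwd k}"
proof -
  obtain N where N: "(1 / 4) ^ N < c - 3"
    using real_arch_pow_inv[of "c - 3" "1/4"] assms by auto
  have "k \<in> (\<lambda>i. Suc (2 * i)) ` {..<N}" if "c < cf.tail k + cf.bwd k" for k
  proof -
    obtain i where i: "k = Suc (2 * i)" "pal (int i) i"
      using value_gt3[of k] \<open>c < cf.tail k + cf.bwd k\<close> assms by auto
    have "\<bar>odd_val (int i) (fin_past (int i) i) - 3\<bar> \<le> (1 / 4) ^ i"
      by (rule pal_odd_val_near3[OF i(2), of 0]) (simp_all add: fin_past_def)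
    then have "(1 / 4) ^ N < (1 / 4 :: real) ^ i"
      using that N unfolding i(1) value_odd by linarith
    then have "i < N" by (simp add: power_strict_decreasing_iff)
    then show ?thesis using i(1) by blast
  qed
  then have "{k. c < cf.tail k + cf.bwd k} \<subseteq> (\<lambda>i. Suc (2 * i)) ` {..<N}" by blast
  then show ?thesis by (rule finite_subset) simp
qed

lemma infinite_value_gt:
  assumes "c < 3"
  shows "infinite {k. c < cf.tail k + cf.bwd k}"
proof -
  obtain d where d: "(1 / 4) ^ d < 3 - c"
    using real_arch_pow_inv[of "3 - c" "1/4"] assms by auto
  have "\<exists>k>m. k \<in> {k. c < cf.tail k + cf.bwd k}" for m
  proof -
    \<comment> \<open>The summand \<open>d\<close> keeps all \<open>d\<close> matched letters inside
      the truncated past; the summand \<open>m\<close> makes the index exceed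
      \<open>m\<close>.\<close>
    obtain i' where "i' \<ge> int (m + d)" "pal i' d" using recurrent[of "int (m + d)" d] by blast
    then have "nat i' \<ge> m + d" "pal (int (nat i')) d" by auto
    then obtain i where i: "i \<ge> m + d" "pal (int i) d" by blast
    have "fin_past (int i) i = steps (past (int i)) d (steps (\<lambda>j. past (int i) (j + d)) (i - d) 0)"
      unfolding fin_past_def using steps_add[of _ d "i - d"] i(1) by simp
    then have "\<bar>odd_val (int i) (fin_past (int i) i) - 3\<bar> \<le> (1 / 4) ^ d"
      by (rule pal_odd_val_near3[OF i(2) steps_nonneg steps_le1[OF digits12_shift[OF digits12_past]], rotated -1])
        simp_all
    then have "c < cf.tail (Suc (2 * i)) + cf.bwd (Suc (2 * i))"
      using d unfolding value_odd by linarith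
    then show ?thesis using i(1) by (intro exI[of _ "Suc (2 * i)"]) auto
  qed
  then show ?thesis by (simp only: infinite_nat_iff_unbounded) blast
qed

lemma lagrange_value_eq3: "lagrange_value pt = 3"
proof (rule antisym)
  have fin: "finite (approx_solutions c pt)" if "c > 3" for c
    unfolding proj_nonneg_digs using that finite_value_gt[of c] by (simp add: cf.approx_solutions_conv)
  show "lagrange_value pt \<le> 3"
    unfolding lagrange_value_def
  proof (rule SUP_least)
    fix c assume "c \<in> {c. c > 0 \<and> infinite (approx_solutions c pt)}"
    then have "\<not> c > 3" using fin by auto
    then show "ereal c \<le> 3" by simp
  qed
  have inf: "infinite (approx_solutions c pt)" if "0 < c" "c < 3" for c
  proof
    assume "finite (approx_solutions c pt)"
    \<comment> \<open>For \<open>c < 2\<close> Legendre's theorem says nothing, but the convergents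
      alone already give infinitely many solutions.\<close>
    moreover have "cf.conv ` {k. c < cf.tail k + cf.bwd k} \<subseteq> approx_solutions c pt"
      unfolding proj_nonneg_digs using cf.conv_in_approx_solutions[OF that(1)] by blast
    ultimately have "finite (cf.conv ` {k. c < cf.tail k + cf.bwd k})" by (rule rev_finite_subset)
    then have "finite {k. c < cf.tail k + cf.bwd k}"
      by (rule finite_imageD) (rule inj_on_subset[OF cf.inj_conv subset_UNIV])
    with infinite_value_gt[OF that(2)] show False by contradiction
  qed
  show "3 \<le> lagrange_value pt"
  proof (rule dense_le)
    fix y :: ereal assume "y < 3"
    show "y \<le> lagrange_value pt"
    proof (cases y)
      case (real r)
      \<comment> \<open>The maximum with 1 keeps the constant positive, as the set in
        \<open>lagrange_value\<close> requires.\<close>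
      define c where "c = max r 1"
      have c: "0 < c" "c < 3" using \<open>y < 3\<close> real by (auto simp: c_def)
      have "y \<le> ereal c" by (simp add: real c_def)
      also have "\<dots> \<le> lagrange_value pt"
        unfolding lagrange_value_def using c inf[OF c] by (intro SUP_upper) simp
      finally show ?thesis .
    qed (use \<open>y < 3\<close> in auto)
  qed
qed

lemma pt_in_Y3: "pt \<in> Y3 (if finite {i. pal (int i) i} then enat (card {i. pal (int i) i}) else \<infinity>)"
proof -
  have "pt \<notin> \<rat>" unfolding proj_nonneg_digs by (rule cf.cf0_irrational)
  moreover have "digs \<in> Sigma_seqs" unfolding Sigma_seqs_def using digs_ge1 by blast
  ultimately show ?thesis
    unfolding Y3_def X3_def mem_Collect_eq
    by (intro conjI bexI[of _ digs] lagrange_value_eq3 num_solutions3_eq markov_value_eq3 refl)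
qed

end

section \<open>Mechanical words\<close>

locale irrational_slope =
  fixes \<theta> :: real
  assumes slope: "0 < \<theta>" "\<theta> < 1" "\<theta> \<notin> \<rat>"
begin

definition F :: "int \<Rightarrow> int" where "F i = \<lfloor>of_int i * \<theta>\<rfloor>"

definition mech :: "int \<Rightarrow> nat" where "mech i = nat (1 + F (i + 1) - F i)"

definition mech_pal :: "int \<Rightarrow> nat \<Rightarrow> bool" where
  "mech_pal i d \<longleftrightarrow> mech i = 2 \<and> mech (i + 1) = 1 \<and>
     (\<forall>j<d. mech (i - 1 - int j) = mech (i + 2 + int j))"

text \<open>Balance: the letter sums of any two blocks of \<open>n\<close> letters differ by at most
  one.\<close>

lemma F_add: "F (i + n) - F i = F n \<or> F (i + n) - F i = F n + 1"
proof -
  have "of_int (i + n) * \<theta> = of_int i * \<theta> + of_int n * \<theta>" by (simp add: algebra_simps)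
  then show ?thesis unfolding F_def by linarith
qed

lemma F_0_1: "F 0 = 0" "F 1 = 0"
  using slope by (simp_all add: F_def floor_eq_iff)

lemma int_mech: "int (mech i) = 1 + F (i + 1) - F i"
  using F_add[of i 1] F_0_1 by (auto simp: mech_def)

lemma mech12: "mech i \<in> {1, 2}"
  using F_add[of i 1] F_0_1 by (auto simp: mech_def)

lemma F_mirror_diff:
  assumes "\<And>j. j < d \<Longrightarrow> mech (i - 1 - int j) = mech (i + 2 + int j)"
  shows "F i - F (i - int d) = F (i + 2 + int d) - F (i + 2)"
  using assms
proof (induction d)
  case (Suc d)
  have "int (mech (i - 1 - int d)) = int (mech (i + 2 + int d))" using Suc.prems[of d] by simp
  then show ?case using Suc by (simp add: int_mech algebra_simps)
qed simp

text \<open>If this failed, the blocks of length \<open>d + 2\<close> on the two sides would have letter sums that differ by two.\<close>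

lemma mech_markoff:
  assumes "\<And>j. j < d \<Longrightarrow> mech (i - 1 - int j) = mech (i + 2 + int j)" "mech i \<noteq> mech (i + 1)"
  shows "\<not> (mech (i - 1 - int d) = mech i \<and> mech (i + 2 + int d) = mech (i + 1))"
proof
  assume *: "mech (i - 1 - int d) = mech i \<and> mech (i + 2 + int d) = mech (i + 1)"
  have 1: "F (i - 1 - int d + 1) - F (i - 1 - int d) = F (i + 1) - F i"
    using int_mech[of "i - 1 - int d"] int_mech[of i] * by simp
  have 2: "F (i + 2 + int d + 1) - F (i + 2 + int d) = F (i + 1 + 1) - F (i + 1)"
    using int_mech[of "i + 2 + int d"] int_mech[of "i + 1"] * by simp
  have 3: "F (i + 1) - F i \<noteq> F (i + 1 + 1) - F (i + 1)"
    using int_mech[of i] int_mech[of "i + 1"] assms(2) by auto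
  have 4: "F i - F (i - int d) = F (i + 2 + int d) - F (i + 2)" by (rule F_mirror_diff[OF assms(1)])
  have e: "i - 1 - int d + 1 = i - int d" "i + 1 + 1 = i + 2" by simp_all
  have 5: "F (i - 1 - int d + (int d + 2)) - F (i - 1 - int d) \<in> {F (int d + 2), F (int d + 2) + 1}"
    "F (i + 1 + (int d + 2)) - F (i + 1) \<in> {F (int d + 2), F (int d + 2) + 1}"
    using F_add by blast+
  have e5: "i - 1 - int d + (int d + 2) = i + 1" "i + 1 + (int d + 2) = i + 2 + int d + 1" by simp_all
  have 6: "F (i + 1) - F i \<in> {0, 1}" "F (i + 2) - F (i + 1) \<in> {0, 1}"
    using F_add[of i 1] F_add[of "i + 1" 1] unfolding F_0_1 e(2) by auto
  show False using 1 2 3 4 5 6 unfolding e e5 by auto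
qed

section \<open>Symmetry of the word about its centre\<close>

lemma mult_notin_Rats: "i \<noteq> 0 \<Longrightarrow> of_int i * \<theta> \<notin> \<rat>"
proof
  assume i: "i \<noteq> 0" and "of_int i * \<theta> \<in> \<rat>"
  then have "of_int i * \<theta> / of_int i \<in> \<rat>" by (intro Rats_divide Rats_of_int)
  then show False using i slope(3) by simp
qed

lemma F_minus: "i \<noteq> 0 \<Longrightarrow> F (- i) = - F i - 1"
proof -
  assume "i \<noteq> 0"
  then have "of_int i * \<theta> \<notin> \<int>" using mult_notin_Rats Ints_subset_Rats by blast
  then have "of_int (F i) \<noteq> of_int i * \<theta>" unfolding F_def by (metis Ints_of_int)
  moreover have "of_int (- i) * \<theta> = - (of_int i * \<theta>)" by simp
  ultimately show ?thesis unfolding F_def by linarith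
qed

text \<open>\<open>F (- i) = - F i - 1\<close> makes the word symmetric about the pair at positions
  -1 and 0, with no limit on \<open>d\<close>. Translates of this symmetry supply the factors needed
  later.\<close>

lemma mech_pal_center: "mech_pal (-1) d"
proof -
  have "mech (-1) = 2" "mech 0 = 1" using F_minus[of 1] F_0_1 by (simp_all add: mech_def)
  moreover have "mech (- 2 - int j) = mech (1 + int j)" for j
  proof -
    have e: "- 2 - int j = - (2 + int j)" "- (2 + int j) + 1 = - (1 + int j)" "1 + int j + 1 = 2 + int j"
      by simp_all
    have "int (mech (- 2 - int j)) = int (mech (1 + int j))"
      unfolding int_mech e using F_minus[of "1 + int j"] F_minus[of "2 + int j"] by simp
    then show ?thesis by simp
  qed
  ultimately show ?thesis by (simp add: mech_pal_def)
qed

section \<open>Fractional parts, translations and recurrence\<close>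

definition fr :: "int \<Rightarrow> real" where "fr i = frac (of_int i * \<theta>)"

lemma fr_eq: "fr i = of_int i * \<theta> - of_int (F i)"
  by (simp add: fr_def frac_def F_def)

lemma fr_bounds: "0 \<le> fr i" "fr i < 1"
  by (simp_all add: fr_def frac_lt_1)

lemma fr_pos: "i \<noteq> 0 \<Longrightarrow> 0 < fr i"
  using mult_notin_Rats[of i] Ints_subset_Rats unfolding fr_def frac_gt_0_iff by blast

lemma fr_minus: "i \<noteq> 0 \<Longrightarrow> fr (- i) = 1 - fr i"
  using F_minus[of i] by (simp add: fr_eq)

text \<open>The distance from \<open>of_int i * \<theta>\<close> to the nearest integer.\<close>

definition nd :: "int \<Rightarrow> real" where "nd i = min (fr i) (1 - fr i)"

lemma nd_pos: "i \<noteq> 0 \<Longrightarrow> 0 < nd i"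
  using fr_pos[of i] fr_bounds[of i] by (simp add: nd_def)

lemma nd_le_fr: "nd i \<le> fr i"
  by (simp add: nd_def)

text \<open>Modulo integers, adding \<open>T * \<theta>\<close> pushes \<open>k * \<theta>\<close>
  to the right by only \<open>fr T\<close>, which is less than its distance to the next integer. So
  the word repeats under translation by \<open>T\<close> on the window from \<open>- L\<close> to
  \<open>L - 1\<close>.\<close>

lemma F_translate:
  assumes "\<And>j. \<lbrakk>1 \<le> j; j \<le> L\<rbrakk> \<Longrightarrow> fr T < nd j" "\<bar>k\<bar> \<le> L"
  shows "F (k + T) = F k + F T"
proof (cases "k = 0")
  case False
  have "fr k + fr T < 1"
  proof (cases "k > 0")
    case True
    then show ?thesis using assms(1)[of k] assms(2) by (simp add: nd_def)
  next
    case False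
    then show ?thesis using assms(1)[of "- k"] assms(2) \<open>k \<noteq> 0\<close> fr_minus[of k] by (simp add: nd_def)
  qed
  moreover have "of_int (k + T) * \<theta> = of_int (F k) + of_int (F T) + (fr k + fr T)"
    by (simp add: fr_eq algebra_simps)
  ultimately show ?thesis
    using fr_bounds(1)[of k] fr_bounds(1)[of T] unfolding F_def[of "k + T"] by linarith
qed (simp add: F_0_1)

lemma mech_translate:
  assumes "\<And>j. \<lbrakk>1 \<le> j; j \<le> L\<rbrakk> \<Longrightarrow> fr T < nd j" "- L \<le> k" "k < L"
  shows "mech (k + T) = mech k"
proof -
  have "F (k + T) = F k + F T" by (rule F_translate[OF assms(1)]) (use assms(2,3) in auto)
  moreover have "F ((k + 1) + T) = F (k + 1) + F T"
    by (rule F_translate[OF assms(1)]) (use assms(2,3) in auto)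
  moreover have "k + T + 1 = (k + 1) + T" by simp
  ultimately show ?thesis unfolding mech_def by (simp only: add_diff_cancel_right')
qed

lemma mech_pal_translate:
  assumes "\<And>j. \<lbrakk>1 \<le> j; j \<le> L\<rbrakk> \<Longrightarrow> fr T < nd j" and "mech_pal i d" "- L \<le> i - int d" "i + 1 + int d < L"
    "- L \<le> i" "i + 1 < L"
  shows "mech_pal (i + T) d"
proof -
  have tr: "mech (k + T) = mech k" if "- L \<le> k" "k < L" for k
    using mech_translate[of L T k] assms(1) that by blast
  have "mech (i + T) = mech i" by (rule tr) (use assms(5,6) in auto)
  moreover have "mech (i + 1 + T) = mech (i + 1)" by (rule tr) (use assms(5,6) in simp_all)
  moreover have "mech (i - 1 - int j + T) = mech (i - 1 - int j)" if "j < d" for j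
  proof -
    have "- L \<le> i - 1 - int j" "i - 1 - int j < L" using assms(3-6) that by linarith+
    then show ?thesis by (rule tr)
  qed
  moreover have "mech (i + 2 + int j + T) = mech (i + 2 + int j)" if "j < d" for j
  proof -
    have "- L \<le> i + 2 + int j" "i + 2 + int j < L" using assms(3-6) that by linarith+
    then show ?thesis by (rule tr)
  qed
  ultimately show ?thesis using assms(2) by (simp add: mech_pal_def algebra_simps)
qed

lemma nd_lower_bound: "\<exists>\<delta>>0. \<forall>j. 1 \<le> j \<and> j \<le> int L \<longrightarrow> \<delta> \<le> nd j"
proof (induction L)
  case 0
  then show ?case by (intro exI[of _ 1]) auto
next
  case (Suc L)
  then obtain \<delta> where \<delta>: "\<delta> > 0" "\<And>j. 1 \<le> j \<Longrightarrow> j \<le> int L \<Longrightarrow> \<delta> \<le> nd j" by blast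
  show ?case
  proof (intro exI conjI allI impI)
    show "min \<delta> (nd (int (Suc L))) > 0" using \<delta>(1) nd_pos[of "int (Suc L)"] by simp
    fix j assume "1 \<le> j \<and> j \<le> int (Suc L)"
    then show "min \<delta> (nd (int (Suc L))) \<le> nd j"
      using \<delta>(2)[of j] by (cases "j = int (Suc L)") auto
  qed
qed

lemma small_fr_pos:
  assumes "\<delta> > 0"
  shows "\<exists>T>0. fr (int T) < \<delta>"
proof -
  define e where "e = min \<delta> 1 / 2"
  have e: "0 < e" "e \<le> 1" "2 * e \<le> \<delta>" using assms by (auto simp: e_def)
  \<comment> \<open>Target \<open>e\<close> with tolerance \<open>e\<close> confines the fractional
    part below \<open>2 * e\<close>, hence below \<open>\<delta>\<close>.\<close>
  then obtain k where "k > 0" "\<bar>frac (real k * \<theta>) - e\<bar> < e"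
    using Kronecker_approx_1_explicit[OF slope(3), of e e] by auto
  then show ?thesis using e by (intro exI[of _ k]) (auto simp: fr_def)
qed

lemma small_fr_neg:
  assumes "\<delta> > 0"
  shows "\<exists>T>0. fr (- int T) < \<delta>"
proof -
  define e where "e = min \<delta> 1 / 2"
  have e: "0 < e" "e \<le> 1" "2 * e \<le> \<delta>" using assms by (auto simp: e_def)
  have "- \<theta> \<notin> \<rat>" using slope(3) by simp
  then obtain k where "k > 0" "\<bar>frac (real k * - \<theta>) - e\<bar> < e"
    using Kronecker_approx_1_explicit[of "- \<theta>" e e] e by auto
  then show ?thesis using e by (intro exI[of _ k]) (auto simp: fr_def)
qed

text \<open>The central factor is translated by some \<open>T\<close> with tiny
  \<open>fr T\<close>.\<close>

lemma recurrence:
  "\<exists>i\<ge>N. mech_pal i d"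
proof -
  obtain \<delta> where \<delta>: "\<delta> > 0" "\<And>j. 1 \<le> j \<Longrightarrow> j \<le> int (nat N + 1 + d + 1) \<Longrightarrow> \<delta> \<le> nd j"
    using nd_lower_bound by blast
  obtain T where T: "T > 0" "fr (int T) < \<delta>" using small_fr_pos[OF \<delta>(1)] by blast
  have less: "fr (int T) < nd j" if "1 \<le> j" "j \<le> int (nat N + 1 + d + 1)" for j
    using T \<delta>(2)[OF that] by simp
  have "mech_pal (-1 + int T) d"
    by (rule mech_pal_translate[OF less mech_pal_center]) auto
  \<comment> \<open>\<open>T\<close> is automatically large: if it lay in the range of
    \<open>less\<close>, then \<open>fr T < nd T\<close> would contradict
    \<open>nd_le_fr\<close>.\<close>
  moreover have "int T > int (nat N + 1 + d + 1)"
  proof (rule ccontr)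
    assume "\<not> int T > int (nat N + 1 + d + 1)"
    then have "fr (int T) < nd (int T)" using T(1) by (intro less) linarith+
    then show False using nd_le_fr[of "int T"] by linarith
  qed
  then have "-1 + int T \<ge> N" by linarith
  ultimately show ?thesis by blast
qed

text \<open>Two consecutive records \<open>p < q\<close> of \<open>nd\<close> cannot both be attained from below, since then \<open>q - p\<close>
  would be a better approximation than \<open>p\<close>.\<close>

lemma best_approximations_above:
  "\<exists>q>N. \<forall>j. 1 \<le> j \<and> j < int q \<longrightarrow> fr (int q) < nd j"
proof -
  have next_record: "\<exists>p\<ge>1. nd (int p) < \<delta> \<and> (\<forall>j. 1 \<le> j \<and> j < int p \<longrightarrow> \<delta> \<le> nd j)"
    if pos: "\<delta> > 0" for \<delta>
  proof -
    obtain T where "T > 0" "fr (int T) < \<delta>" using small_fr_pos[OF pos] by blast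
    then have ex: "\<exists>p::nat. p \<ge> 1 \<and> nd (int p) < \<delta>"
      using nd_le_fr[of "int T"] by (intro exI[of _ T]) linarith
    define p where "p = (LEAST p::nat. p \<ge> 1 \<and> nd (int p) < \<delta>)"
    have p: "p \<ge> 1 \<and> nd (int p) < \<delta>" unfolding p_def by (rule LeastI_ex[OF ex])
    have "\<delta> \<le> nd j" if "1 \<le> j" "j < int p" for j
    proof -
      have "nat j < (LEAST p::nat. p \<ge> 1 \<and> nd (int p) < \<delta>)" using that unfolding p_def by linarith
      from not_less_Least[OF this] show ?thesis using that(1) by (simp add: not_less Suc_le_eq)
    qed
    then show ?thesis using p by blast
  qed
  obtain \<delta> where \<delta>: "\<delta> > 0" "\<And>j. 1 \<le> j \<Longrightarrow> j \<le> int N \<Longrightarrow> \<delta> \<le> nd j" using nd_lower_bound by blast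
  obtain p where p: "p \<ge> 1" "nd (int p) < \<delta>" "\<And>j. 1 \<le> j \<Longrightarrow> j < int p \<Longrightarrow> \<delta> \<le> nd j"
    using next_record[OF \<delta>(1)] by blast
  obtain q where q: "q \<ge> 1" "nd (int q) < nd (int p)"
    "\<And>j. 1 \<le> j \<Longrightarrow> j < int q \<Longrightarrow> nd (int p) \<le> nd j"
    using next_record[OF nd_pos[of "int p"]] p(1) by auto
  have "p > N"
  proof (rule ccontr)
    assume "\<not> p > N"
    then have "\<delta> \<le> nd (int p)" using p(1) by (intro \<delta>(2)) simp_all
    then show False using p(2) by simp
  qed
  have "q > p"
  proof (rule ccontr)
    assume "\<not> q > p"
    then have "q < p" using q(2) by (cases "q = p") auto
    then show False using p(2) p(3)[of "int q"] q(1,2) by simp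
  qed
  show ?thesis
  proof (cases "fr (int p) \<le> 1 / 2")
    case True
    then have "fr (int p) = nd (int p)" by (simp add: nd_def)
    then have "fr (int p) < nd j" if "1 \<le> j" "j < int p" for j
      using p(2) p(3)[OF that] by linarith
    then show ?thesis using \<open>p > N\<close> by blast
  next
    case False
    then have ndp: "nd (int p) = 1 - fr (int p)" by (simp add: nd_def)
    have "fr (int q) \<le> 1 / 2"
    proof (rule ccontr)
      assume "\<not> fr (int q) \<le> 1 / 2"
      then have ndq: "nd (int q) = 1 - fr (int q)" by (simp add: nd_def)
      have d: "fr (int q) - fr (int p) > 0" using q(2) ndp ndq by simp
      have "of_int (int q - int p) * \<theta> = of_int (F (int q) - F (int p)) + (fr (int q) - fr (int p))"
        by (simp add: fr_eq algebra_simps)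
      then have "F (int q - int p) = F (int q) - F (int p)"
        unfolding F_def[of "int q - int p"] using d fr_bounds[of "int q"] fr_bounds[of "int p"] by linarith
      then have "fr (int q - int p) = fr (int q) - fr (int p)"
        by (simp add: fr_eq algebra_simps)
      then have "nd (int q - int p) < nd (int p)"
        using ndp fr_bounds(2)[of "int q"] by (simp add: nd_def)
      then show False using q(3)[of "int q - int p"] \<open>q > p\<close> p(1) by simp
    qed
    then have "fr (int q) = nd (int q)" by (simp add: nd_def)
    then have "fr (int q) < nd j" if "1 \<le> j" "j < int q" for j
      using q(2) q(3)[OF that] by linarith
    moreover have "q > N" using \<open>q > p\<close> \<open>p > N\<close> by simp
    ultimately show ?thesis by blast
  qed
qed

section \<open>Counting the factors \<open>rev w 2 1 w\<close> whose first letter stands at position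
  \<open>h\<close>\<close>

definition sols :: "int \<Rightarrow> nat set" where "sols h = {n. mech_pal (h + int n) n}"

text \<open>Since \<open>F 0 = 0\<close>, mirror symmetry would give
  \<open>F (2 * n + 2) = 2 * F (n + 1) - 1\<close>, whereas doubling a number at least doubles its
  floor.\<close>

lemma sols_0: "sols 0 = {}"
proof -
  have "\<not> mech_pal (int n) n" for n
  proof
    assume n: "mech_pal (int n) n"
    then have n1: "mech (int n) = 2" "mech (int n + 1) = 1" by (simp_all only: mech_pal_def)
    have e: "int n + 1 + 1 = int n + 2" by simp
    from n have "F (int n) - F (int n - int n) = F (int n + 2 + int n) - F (int n + 2)"
      unfolding mech_pal_def by (intro F_mirror_diff) blast
    moreover have "F (int n + 1) = F (int n) + 1"
      using n1 int_mech[of "int n"] by simp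
    moreover have "F (int n + 2) = F (int n + 1)"
      using n1 int_mech[of "int n + 1"] unfolding e by simp
    ultimately have "F (int n + 2 + int n) = 2 * F (int n + 1) - 1" by (simp add: F_0_1)
    moreover have "of_int (int n + 2 + int n) * \<theta> = 2 * (of_int (int n + 1) * \<theta>)"
      by (simp add: algebra_simps)
    ultimately show False unfolding F_def by linarith
  qed
  then show ?thesis by (simp add: sols_def)
qed

text \<open>For a best approximation \<open>q\<close> from above, translation by \<open>q\<close>
  preserves the window from \<open>- (q - 1)\<close> to \<open>q - 2\<close>. This is exactly the
  central factor with \<open>d = q - 2\<close>, and its translate begins at position 1.\<close>

lemma infinite_sols_1: "infinite (sols 1)"
proof -
  have "\<exists>n>m. n \<in> sols 1" for m
  proof -
    obtain q where q: "q > m + 2" "\<And>j. 1 \<le> j \<Longrightarrow> j < int q \<Longrightarrow> fr (int q) < nd j"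
      using best_approximations_above[of "m + 2"] by blast
    have "mech_pal (-1 + int q) (q - 2)"
    proof (rule mech_pal_translate[OF _ mech_pal_center])
      show "fr (int q) < nd j" if "1 \<le> j" "j \<le> int q - 1" for j using that by (intro q(2)) auto
    qed (use q(1) in auto)
    moreover have "-1 + int q = 1 + int (q - 2)" using q(1) by simp
    ultimately have "q - 2 \<in> sols 1" by (simp only: sols_def mem_Collect_eq)
    then show ?thesis using q(1) by (intro exI[of _ "q - 2"]) auto
  qed
  then show ?thesis by (simp only: infinite_nat_iff_unbounded) blast
qed

text \<open>Dropping the two outer letters keeps the centre and moves the start from
  \<open>h - 1\<close> to \<open>h\<close>; only half-length 0 has nothing to drop.\<close>

lemma sols_step: "sols (h - 1) \<subseteq> insert 0 (Suc ` sols h)"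
proof
  fix n assume n: "n \<in> sols (h - 1)"
  show "n \<in> insert 0 (Suc ` sols h)"
  proof (cases n)
    case (Suc m)
    have e: "h - 1 + int n = h + int m" using Suc by simp
    have "mech_pal (h + int m) n" using n unfolding sols_def mem_Collect_eq e .
    then have "mech_pal (h + int m) m" unfolding mech_pal_def Suc by (meson less_SucI)
    then have "m \<in> sols h" by (simp only: sols_def mem_Collect_eq)
    then show ?thesis using Suc by simp
  qed simp
qed

lemma finite_sols: "finite (sols (- int m))"
proof (induction m)
  case (Suc m)
  have "finite (sols (- int m - 1))" by (rule finite_subset[OF sols_step]) (use Suc in simp)
  moreover have "- int m - 1 = - int (Suc m)" by simp
  ultimately show ?case by (simp only:)
qed (simp add: sols_0)

lemma card_sols_step: "card (sols (- int (Suc m))) \<le> Suc (card (sols (- int m)))"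
proof -
  have "card (sols (- int m - 1)) \<le> card (insert 0 (Suc ` sols (- int m)))"
    using finite_sols by (intro card_mono sols_step) auto
  also have "\<dots> \<le> Suc (card (Suc ` sols (- int m)))" by (simp add: card_insert_if finite_sols)
  also have "card (Suc ` sols (- int m)) = card (sols (- int m))" by (simp add: card_image)
  finally have "card (sols (- int m - 1)) \<le> Suc (card (sols (- int m)))" .
  moreover have "- int m - 1 = - int (Suc m)" by simp
  ultimately show ?thesis by (simp only:)
qed

text \<open>Any \<open>n\<close> of the factors that begin at position 1 lie in a bounded window. It
  recurs under translation by \<open>- T\<close> when \<open>fr (- T)\<close> is tiny, so all
  \<open>n\<close> of them also begin at \<open>1 - T\<close>.\<close>

lemma card_sols_unbounded: "\<exists>m. n \<le> card (sols (- int m))"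
proof -
  obtain B where B: "B \<subseteq> sols 1" "finite B" "card B = n"
    using infinite_arbitrarily_large[OF infinite_sols_1, of n] by blast
  obtain M where M: "\<And>b. b \<in> B \<Longrightarrow> b \<le> M" using Max_ge[OF B(2)] by blast
  \<comment> \<open>The chosen factors occupy positions 1 to at most
    \<open>2 * M + 2\<close>.\<close>
  obtain \<delta> where \<delta>: "\<delta> > 0" "\<And>j. 1 \<le> j \<Longrightarrow> j \<le> int (2 * M + 3) \<Longrightarrow> \<delta> \<le> nd j"
    using nd_lower_bound by blast
  obtain T where T: "T > 0" "fr (- int T) < \<delta>" using small_fr_neg[OF \<delta>(1)] by blast
  have less: "fr (- int T) < nd j" if "1 \<le> j" "j \<le> int (2 * M + 3)" for j
    using T \<delta>(2)[OF that] by simp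
  have "b \<in> sols (- int (T - 1))" if b: "b \<in> B" for b
  proof -
    have "mech_pal (1 + int b) b" using B(1) b by (auto simp: sols_def)
    then have "mech_pal (1 + int b + - int T) b"
      using M[OF b] by (intro mech_pal_translate[OF less]) auto
    moreover have "1 + int b + - int T = - int (T - 1) + int b" using T(1) by simp
    ultimately show ?thesis by (simp only: sols_def mem_Collect_eq)
  qed
  then have "card B \<le> card (sols (- int (T - 1)))" by (intro card_mono finite_sols subsetI)
  then show ?thesis using B(3) by blast
qed

text \<open>Moving the starting point one step to the left creates at most one new solution, so all
  counts between \<open>0\<close> and an arbitrarily large one occur.\<close>

lemma card_sols_attained: "\<exists>h. finite (sols h) \<and> card (sols h) = n"
proof -
  define m where "m = (LEAST m. n \<le> card (sols (- int m)))"
  have m1: "n \<le> card (sols (- int m))"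
    unfolding m_def by (rule LeastI_ex[OF card_sols_unbounded])
  have m2: "card (sols (- int k)) < n" if "k < m" for k
    using not_less_Least[OF that[unfolded m_def]] by (simp only: not_le)
  have "card (sols (- int m)) \<le> n"
  proof (cases m)
    case 0
    then show ?thesis by (simp add: sols_0)
  next
    case (Suc k)
    then show ?thesis using m2[of k] card_sols_step[of k] by simp
  qed
  then have "card (sols (- int m)) = n" using m1 by simp
  with finite_sols show ?thesis by blast
qed

lemma recurrent_markoff_word_mech: "recurrent_markoff_word (\<lambda>i. mech (i + h))"
proof -
  have e: "i - 1 - int x + h = i + h - 1 - int x" "i + 2 + int x + h = i + h + 2 + int x"
    "i + 1 + h = i + h + 1" "i + 2 + h = i + h + 2" for i x by simp_all
  interpret markoff_word "\<lambda>i. mech (i + h)"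
  proof
    show "mech (i + h) \<in> {1, 2}" for i by (rule mech12)
  next
    fix d i
    assume "\<And>j. j < d \<Longrightarrow> mech (i - 1 - int j + h) = mech (i + 2 + int j + h)" "mech (i + h) \<noteq> mech (i + 1 + h)"
    then show "\<not> (mech (i - 1 - int d + h) = mech (i + h) \<and> mech (i + 2 + int d + h) = mech (i + 1 + h))"
      unfolding e by (rule mech_markoff)
  qed
  show ?thesis
  proof
    fix N d
    obtain i where i: "i \<ge> N + h" "mech_pal i d" using recurrence by blast
    have "pal (i - h) d"
      using i(2) unfolding pal_def mech_pal_def past_def future_def e by simp
    moreover have "N \<le> i - h" using i(1) by simp
    ultimately show "\<exists>i\<ge>N. pal i d" by blast
  qed
qed

definition pt :: "int \<Rightarrow> real" where "pt h = dval (\<lambda>j. mech (h + int j))"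

lemma pt_in_Y3: "pt h \<in> Y3 (if finite (sols h) then enat (card (sols h)) else \<infinity>)"
proof -
  interpret w: recurrent_markoff_word "\<lambda>i. mech (i + h)" by (rule recurrent_markoff_word_mech)
  have e: "int n - 1 - int j + h = h + int n - 1 - int j" "int n + 2 + int j + h = h + int n + 2 + int j"
    "int n + h = h + int n" "int n + 1 + h = h + int n + 1" "0 + int n + h = h + int n" for n j by simp_all
  have "w.pal (int n) n \<longleftrightarrow> mech_pal (h + int n) n" for n
    unfolding w.pal_def mech_pal_def w.past_def w.future_def e ..
  then have "{n. w.pal (int n) n} = sols h" by (simp only: sols_def)
  moreover have "cf0 (proj_nonneg w.digs) = pt h"
    unfolding w.proj_nonneg_digs pt_def dval_def w.future_def e ..
  ultimately show ?thesis using w.pt_in_Y3 by (simp only:)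
qed

lemma Y3_attained: "\<exists>h. pt h \<in> Y3 n"
proof (cases n)
  case (enat k)
  obtain h where "finite (sols h)" "card (sols h) = k" using card_sols_attained by blast
  then have "pt h \<in> Y3 n" using pt_in_Y3[of h] enat by simp
  then show ?thesis ..
next
  case infinity
  then have "pt 1 \<in> Y3 n" using pt_in_Y3[of 1] infinite_sols_1 by simp
  then show ?thesis ..
qed

section \<open>Recovering the slope from the point\<close>

lemma F_sum: "F (h + int n) - F h = (\<Sum>j<n. int (mech (h + int j)) - 1)"
proof (induction n)
  case (Suc n)
  have "h + int (Suc n) = h + int n + 1" by simp
  then show ?case using Suc int_mech[of "h + int n"] by (simp only: sum.lessThan_Suc)
qed simp

end

text \<open>Equal points have equal words by \<open>dval_inj\<close>, and the slope is the frequency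
  of the letter 2 in the word.\<close>

lemma pt_inj:
  assumes "irrational_slope \<theta>" "irrational_slope \<phi>" "irrational_slope.pt \<theta> h = irrational_slope.pt \<phi> k"
  shows "\<theta> = \<phi>"
proof (rule ccontr)
  assume "\<theta> \<noteq> \<phi>"
  interpret a: irrational_slope \<theta> by fact
  interpret b: irrational_slope \<phi> by fact
  have "digits12 (\<lambda>j. a.mech (h + int j))" "digits12 (\<lambda>j. b.mech (k + int j))"
    unfolding digits12_def using a.mech12 b.mech12 by blast+
  then have "(\<lambda>j. a.mech (h + int j)) = (\<lambda>j. b.mech (k + int j))"
    by (rule dval_inj) (use assms(3) in \<open>simp only: a.pt_def b.pt_def\<close>)
  then have eq: "a.mech (h + int j) = b.mech (k + int j)" for j by (rule fun_cong)
  \<comment> \<open>Each increment of \<open>F\<close> over \<open>n\<close> letters differs from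
    \<open>n\<close> times its slope by less than 1, and the two increments agree.\<close>
  have bound: "\<bar>real n * (\<theta> - \<phi>)\<bar> \<le> 2" for n
  proof -
    have "a.F (h + int n) - a.F h = b.F (k + int n) - b.F k"
      unfolding a.F_sum b.F_sum eq ..
    then have *: "real_of_int (a.F (h + int n)) - a.F h = real_of_int (b.F (k + int n)) - b.F k"
      by (simp only: of_int_diff[symmetric])
    have a: "of_int (a.F i) \<le> of_int i * \<theta>" "of_int i * \<theta> < of_int (a.F i) + 1"
      and b: "of_int (b.F i) \<le> of_int i * \<phi>" "of_int i * \<phi> < of_int (b.F i) + 1" for i
      unfolding a.F_def b.F_def by linarith+
    have **: "real n * (\<theta> - \<phi>) = (of_int (h + int n) * \<theta> - of_int h * \<theta>)
        - (of_int (k + int n) * \<phi> - of_int k * \<phi>)" by (simp add: algebra_simps)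
    show ?thesis
      using * ** a[of h] a[of "h + int n"] b[of k] b[of "k + int n"] by linarith
  qed
  obtain n where "2 < real n * \<bar>\<theta> - \<phi>\<bar>"
    using reals_Archimedean3[of "\<bar>\<theta> - \<phi>\<bar>"] \<open>\<theta> \<noteq> \<phi>\<close> by auto
  then show False using bound[of n] by (simp add: abs_mult)
qed

theorem theorem1p2:
  fixes n :: enat
  shows "uncountable (Y3 n)"
proof
  assume "countable (Y3 n)"
  let ?I = "{0<..<1} - \<rat> :: real set"
  have slope: "irrational_slope \<theta>" if "\<theta> \<in> ?I" for \<theta>
    using that by unfold_locales auto
  have ex: "\<forall>\<theta>\<in>?I. \<exists>h. irrational_slope.pt \<theta> h \<in> Y3 n"
    by (intro ballI irrational_slope.Y3_attained slope)
  \<comment> \<open>The starting position depends on the slope; injectivity of \<open>g\<close>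
    survives because \<open>pt_inj\<close> allows two different positions.\<close>
  from bchoice[OF ex] obtain H where H: "\<forall>\<theta>\<in>?I. irrational_slope.pt \<theta> (H \<theta>) \<in> Y3 n" ..
  define g where "g = (\<lambda>\<theta>. irrational_slope.pt \<theta> (H \<theta>))"
  have "countable (g ` ?I)"
    by (rule countable_subset[OF _ \<open>countable (Y3 n)\<close>]) (use H in \<open>simp only: g_def image_subset_iff\<close>)
  moreover have "inj_on g ?I"
    unfolding g_def by (rule inj_onI) (rule pt_inj[OF slope slope])
  ultimately have "countable ?I" by (rule countable_image_inj_on)
  moreover have "uncountable ?I"
    using uncountable_open_interval[of 0 "1::real"] by (intro uncountable_minus_countable countable_rat) simp
  ultimately show False by contradiction
qed

end
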